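(* Let $p\in[1,+\infty)$ and let $(\varphi_n)$ be a sequence of non-negative functions in $L^p(\mathbb{R}_+)$ that converges in $L^p$ towards a function $\varphi$. Then, up to extraction of a subsequence, the sequence of tampings $(\varphi_n^\natural)$ converges strongly in $L^p(\mathbb{R}_+)$ towards a function $\psi$ that satisfies, for every $\nu>0$, $$\mathrm{meas}\{\psi\geq\nu\}\;=\;\mathrm{meas}\{\varphi\geq\nu\}.$$
   Context: $\mathbb{R}_+=[0,+\infty)$, $\mathrm{meas}$ is Lebesgue measure, $A\triangle B=(A\cup B)\setminus(A\cap B)$, $\mathfrak{M}_+(\mathbb{R}_+)$ is the set of non-negative measurable functions on $\mathbb{R}_+$ (identified when equal a.e.), and $\{\varphi\ge\nu\}=\{x\in\mathbb{R}_+:\varphi(x)\ge\nu\}$. Hollows. For $A\subseteq\mathbb{R}_+$ measurable, the essential convex hull is $\mathrm{conv\,ess}\,A:=\bigcap_{\mathrm{meas}(A\triangle B)=0}\mathrm{conv}\,B$. The hollows of $A$ are $\mathcal{H}(A):=(\mathrm{conv\,ess}\,A)\setminus A$ (understood up to null sets). For $\varphi\in\mathfrak{M}_+(\mathbb{R}_+)$ and $\nu\in(0,+\infty]$, $\mathcal{H}_\nu(\varphi):=\bigcup_{\lambda<\nu}\mathcal{H}(\{\varphi\ge\lambda\})$. Tamping. For $\nu>0$ let $x_\nu(\varphi):=\mathrm{inf\,ess}\{\varphi\ge\nu\}$, where $\mathrm{inf\,ess}\,A:=\sup\{a\ge0:\mathrm{meas}(A\cap[0,a])=0\}$, and, when $\mathrm{meas}\{\varphi\ge\nu\}>0$,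 $y_\nu(\varphi):=x_\nu(\varphi)-\mathrm{meas}(\mathcal{H}_\infty(\varphi)\cap[0,x_\nu(\varphi)])$. Put $S_\nu(\varphi):=[\,y_\nu(\varphi),\,y_\nu(\varphi)+\mathrm{meas}\{\varphi\ge\nu\}\,]$ (meaning $\emptyset$ if $\mathrm{meas}\{\varphi\ge\nu\}=0$, and $[y_\nu(\varphi),+\infty)$ if it is $+\infty$). These sets are non-increasing in $\nu$. The tamping $\varphi^\natural$ of $\varphi$ is the function whose superlevel sets $\{\varphi^\natural\ge\nu\}$ are the $S_\nu(\varphi)$; explicitly $\varphi^\natural(x):=\sup\{\nu>0: x\in S_\nu(\varphi)\}$ with $\sup\emptyset=0$ (for almost every $\nu$, $\{\varphi^\natural\ge\nu\}=S_\nu(\varphi)$ up to a null set). *)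

theory Defs
  imports "HOL-Analysis.Analysis"
begin

abbreviation half_line :: "real measure" where
  "half_line \<equiv> lebesgue_on {0..}"

definition Lp :: "real \<Rightarrow> (real \<Rightarrow> real) set" where
  "Lp p = {f \<in> borel_measurable half_line. integrable half_line (\<lambda>x. \<bar>f x\<bar> powr p)}"

definition Lp_norm :: "real \<Rightarrow> (real \<Rightarrow> real) \<Rightarrow> real" where
  "Lp_norm p f = (LINT x|half_line. \<bar>f x\<bar> powr p) powr (1 / p)"

definition superlevel :: "(real \<Rightarrow> 'a::ord) \<Rightarrow> 'a \<Rightarrow> real set" where
  "superlevel \<phi> \<nu> = {x. 0 \<le> x \<and> \<nu> \<le> \<phi> x}"

text \<open>Membership in \<open>null_sets\<close> rather than \<open>emeasure lebesgue _ = 0\<close>, because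
  \<open>emeasure\<close> also vanishes on non-measurable sets.\<close>

definition ess_conv :: "real set \<Rightarrow> real set" where
  "ess_conv A = (\<Inter>B \<in> {B. B \<subseteq> {0..} \<and> sym_diff A B \<in> null_sets lebesgue}. convex hull B)"

definition hollows :: "real set \<Rightarrow> real set" where
  "hollows A = ess_conv A - A"

text \<open>Although the union is uncountable, it is measurable and does not depend, up to null sets,
  on the representative of \<open>\<phi>\<close>: the sets \<open>ess_conv (superlevel \<phi> \<mu>)\<close> decrease with \<open>\<mu>\<close>, so
  the union over rational \<open>\<mu>\<close> is the same set.\<close>

definition hollows_below :: "ennreal \<Rightarrow> (real \<Rightarrow> ennreal) \<Rightarrow> real set" where
  "hollows_below \<nu> \<phi> = (\<Union>\<mu> \<in> {..<\<nu>}. hollows (superlevel \<phi> \<mu>))"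

definition inf_ess :: "real set \<Rightarrow> ennreal" where
  "inf_ess A = Sup {ennreal a | a. 0 \<le> a \<and> emeasure lebesgue (A \<inter> {0..a}) = 0}"

definition tamp_x :: "(real \<Rightarrow> ennreal) \<Rightarrow> ennreal \<Rightarrow> ennreal" where
  "tamp_x \<phi> \<nu> = inf_ess (superlevel \<phi> \<nu>)"

text \<open>The value \<open>tamp_y \<phi> \<nu>\<close> is meaningful only if \<open>superlevel \<phi> \<nu>\<close> has positive measure.
  In that case \<open>tamp_x \<phi> \<nu>\<close> is finite and bounds the subtracted measure, so the
  subtraction on \<^typ>\<open>ennreal\<close> is not truncated.\<close>

definition tamp_y :: "(real \<Rightarrow> ennreal) \<Rightarrow> ennreal \<Rightarrow> ennreal" where
  "tamp_y \<phi> \<nu> = tamp_x \<phi> \<nu> -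
     emeasure lebesgue (hollows_below top \<phi> \<inter> {t. 0 \<le> t \<and> ennreal t \<le> tamp_x \<phi> \<nu>})"

text \<open>If \<open>superlevel \<phi> \<nu>\<close> has infinite measure, the upper bound is \<open>top\<close> and the interval is
  unbounded.\<close>

definition tamp_interval :: "(real \<Rightarrow> ennreal) \<Rightarrow> ennreal \<Rightarrow> real set" where
  "tamp_interval \<phi> \<nu> =
     (if emeasure lebesgue (superlevel \<phi> \<nu>) = 0 then {}
      else {x. 0 \<le> x \<and> tamp_y \<phi> \<nu> \<le> ennreal x \<and>
               ennreal x \<le> tamp_y \<phi> \<nu> + emeasure lebesgue (superlevel \<phi> \<nu>)})"

text \<open>The values lie in \<^typ>\<open>ennreal\<close>, since the supremum may be infinite: for a \<open>\<phi>\<close> that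
  decreases from \<open>\<infinity>\<close> at the origin, every interval contains \<open>0\<close>. The supremum of the empty set
  is \<open>0\<close>.\<close>

definition tamping :: "(real \<Rightarrow> ennreal) \<Rightarrow> real \<Rightarrow> ennreal" where
  "tamping \<phi> x = Sup {\<nu>. 0 < \<nu> \<and> \<nu> < top \<and> x \<in> tamp_interval \<phi> \<nu>}"

end

theory Submission
  imports Defs "HOL-Library.Diagonal_Subsequence"
begin

text \<open>For \<open>\<kappa> \<le> \<nu>\<close>, a point strictly between the essential infima of \<open>{u \<ge> \<kappa>}\<close> and \<open>{u \<ge> \<nu>}\<close>
  that is not in a hollow lies in \<open>{u \<ge> \<kappa>}\<close>. Hence the intervals \<open>S\<^sub>\<nu>(u)\<close> are nested, and the
  tamping of \<open>u\<close> is equimeasurable with \<open>u\<close> and has intervals as superlevel sets. Functions of the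
  latter kind satisfy a Helly selection principle, so a subsequence of the tampings converges almost
  everywhere. As the sequence converges in measure, the superlevel sets of its tampings stay in
  bounded intervals, and the limit is equimeasurable with \<open>\<phi>\<close>. The \<open>p\<close>-th powers of the tampings
  then have converging integrals, and Scheffe's lemma together with
  \<open>\<bar>a - b\<bar>\<^sup>p \<le> \<bar>a\<^sup>p - b\<^sup>p\<bar>\<close> gives convergence in \<open>L\<^sup>p\<close>.\<close>

text \<open>The limit need not be the tamping of \<open>\<phi>\<close>. Let \<open>\<phi>\<close> be
  the indicator of [1,2] and \<open>\<phi>s n\<close>, for n \<ge> 2, that of [0,1/n] \<union>
  [1,2]. Then \<open>\<phi>\<close> is its own tamping, while the gap (1/n,1) is a hollow of
  \<open>\<phi>s n\<close> and the tampings tend to the indicator of [0,1]. Mixing both kinds of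
  behaviour shows why a subsequence must be extracted. Positions therefore come from compactness
  alone, and only the distribution of values is followed to the limit. Mass cannot escape because
  tamping moves superlevel sets to the left: \<open>tamp_y\<close> never exceeds
  \<open>tamp_x\<close>. Convergence compares measures at slightly different levels only; since
  positive levels of an L^p function have superlevel sets of finite measure, these measures are
  left-continuous in the level, and the comparisons close up to equalities.\<close>

section \<open>Power inequalities and integrals of p-th powers\<close>

lemma powr_superadditive:
  fixes p x y :: real
  assumes "1 \<le> p" "0 \<le> x" "0 \<le> y"
  shows "x powr p + y powr p \<le> (x + y) powr p"
proof -
  have *: "z powr p \<le> z * (x + y) powr (p - 1)" if "0 \<le> z" "z \<le> x + y" for z
  proof (cases "z = 0")
    case False
    then have "z powr p = z * z powr (p - 1)"
      using that by (simp add: powr_diff)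
    also have "\<dots> \<le> z * (x + y) powr (p - 1)"
      using that assms by (intro mult_left_mono powr_mono2) auto
    finally show ?thesis .
  qed simp
  have "x powr p + y powr p \<le> x * (x + y) powr (p - 1) + y * (x + y) powr (p - 1)"
    using assms by (intro add_mono *) auto
  also have "\<dots> = (x + y) powr p"
    by (cases "x + y = 0") (use assms in \<open>auto simp: powr_diff simp flip: distrib_right add_divide_distrib\<close>)
  finally show ?thesis .
qed

lemma powr_abs_diff_le:
  fixes p x y :: real
  assumes "1 \<le> p" "0 \<le> x" "0 \<le> y"
  shows "\<bar>x - y\<bar> powr p \<le> \<bar>x powr p - y powr p\<bar>"
proof (cases "x \<le> y")
  case True
  then show ?thesis
    using powr_superadditive[of p x "y - x"] assms by (simp add: abs_if)
next
  case False
  then show ?thesis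
    using powr_superadditive[of p y "x - y"] assms by (simp add: abs_if)
qed

text \<open>Convexity of z^p at x/(1-t) and y/t with weights 1-t and t. The weight stays free
  because the coefficient of \<open>x powr p\<close> tends to 1 as t tends to 0, so that an error y
  is absorbed at almost no cost.\<close>

lemma powr_add_le_weighted:
  fixes p t x y :: real
  assumes "1 \<le> p" "0 < t" "t < 1" "0 \<le> x" "0 \<le> y"
  shows "(x + y) powr p \<le> (1 - t) powr (1 - p) * x powr p + t powr (1 - p) * y powr p"
proof -
  have ge1: "1 \<le> s powr (1 - p)" if "0 < s" "s < 1" for s :: real
    using powr_mono2'[of "1 - p" s 1] assms that by simp
  consider "x = 0" | "y = 0" | "0 < x" "0 < y"
    using assms by linarith
  then show ?thesis
  proof cases
    case 1
    then show ?thesis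
      using ge1[of t] assms by (simp add: mult_le_cancel_right1)
  next
    case 2
    then show ?thesis
      using ge1[of "1 - t"] assms by (simp add: mult_le_cancel_right1)
  next
    case 3
    have *: "s * (z / s) powr p = s powr (1 - p) * z powr p" if "0 < s" "0 < z" for s z :: real
      using that by (simp add: powr_divide powr_diff)
    have "((1 - t) * (x / (1 - t)) + t * (y / t)) powr p
        \<le> (1 - t) * (x / (1 - t)) powr p + t * (y / t) powr p"
      using convex_onD[OF powr_convex[OF assms(1)], of t "x / (1 - t)" "y / t"] assms 3 by simp
    then show ?thesis
      using assms 3 by (simp add: *)
  qed
qed

text \<open>Tonelli's theorem for the region 0 < s \<le> f x. The cut at 0 < s leaves only positive
  levels, those at which distributions are compared.\<close>

lemma nn_integral_layer_cake:
  assumes "sigma_finite_measure M" and [measurable]: "f \<in> borel_measurable M" and nn: "\<And>x. 0 \<le> f x"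
  shows "(\<integral>\<^sup>+x. ennreal (f x) \<partial>M) =
    (\<integral>\<^sup>+s. emeasure M {x \<in> space M. s \<le> f x} * indicator {0<..} s \<partial>lborel)"
proof -
  interpret pair_sigma_finite M lborel
    using assms(1) by (intro pair_sigma_finite.intro sigma_finite_lborel)
  have "(\<integral>\<^sup>+x. ennreal (f x) \<partial>M) = (\<integral>\<^sup>+x. (\<integral>\<^sup>+s. indicator {0<..f x} s \<partial>lborel) \<partial>M)"
    using nn by simp
  also have "\<dots> = (\<integral>\<^sup>+x. (\<integral>\<^sup>+s. (if 0 < s \<and> s \<le> f x then 1 else 0) \<partial>lborel) \<partial>M)"
    by (intro nn_integral_cong) (auto simp: indicator_def)
  also have "\<dots> = (\<integral>\<^sup>+s. (\<integral>\<^sup>+x. (if 0 < s \<and> s \<le> f x then 1 else 0) \<partial>M) \<partial>lborel)"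
    by (rule Fubini'[symmetric]) measurable
  also have "\<dots> = (\<integral>\<^sup>+s. emeasure M {x \<in> space M. s \<le> f x} * indicator {0<..} s \<partial>lborel)"
  proof (intro nn_integral_cong)
    fix s
    have "(\<integral>\<^sup>+x. (if 0 < s \<and> s \<le> f x then 1 else 0) \<partial>M)
        = (\<integral>\<^sup>+x. indicator {0<..} s * indicator {x \<in> space M. s \<le> f x} x \<partial>M)"
      by (intro nn_integral_cong) (auto simp: indicator_def)
    also have "\<dots> = emeasure M {x \<in> space M. s \<le> f x} * indicator {0<..} s"
      by (subst nn_integral_cmult_indicator) (auto simp: mult.commute)
    finally show "(\<integral>\<^sup>+x. (if 0 < s \<and> s \<le> f x then 1 else 0) \<partial>M)
        = emeasure M {x \<in> space M. s \<le> f x} * indicator {0<..} s" .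
  qed
  finally show ?thesis .
qed

text \<open>For s > 0, \<open>s \<le> f x powr p\<close> is the superlevel condition at
  \<open>s powr (1 / p)\<close>, so both layer-cake formulas have the same integrand.\<close>

lemma nn_integral_powr_equimeasurable:
  fixes p :: real
  assumes M: "sigma_finite_measure M" and [measurable]: "f \<in> borel_measurable M" "g \<in> borel_measurable M"
    and nn: "\<And>x. 0 \<le> f x" "\<And>x. 0 \<le> g x" and p: "0 < p"
    and eq: "\<And>\<nu>. 0 < \<nu> \<Longrightarrow>
      emeasure M {x \<in> space M. \<nu> \<le> f x} = emeasure M {x \<in> space M. \<nu> \<le> g x}"
  shows "(\<integral>\<^sup>+x. ennreal (f x powr p) \<partial>M) = (\<integral>\<^sup>+x. ennreal (g x powr p) \<partial>M)"
proof -
  have *: "s \<le> a powr p \<longleftrightarrow> s powr (1 / p) \<le> a" if "0 < s" "0 \<le> a" for s a :: real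
    using powr_mono2[of p "s powr (1 / p)" a] powr_less_mono2[of p a "s powr (1 / p)"] p that
    by (fastforce simp: powr_powr not_le[symmetric])
  have "emeasure M {x \<in> space M. s \<le> f x powr p} = emeasure M {x \<in> space M. s \<le> g x powr p}"
    if "0 < s" for s
    using eq[of "s powr (1 / p)"] that by (simp add: * nn)
  then show ?thesis
    by (subst (1 2) nn_integral_layer_cake[OF M]) (auto intro!: nn_integral_cong simp: indicator_def)
qed

lemma sigma_finite_half_line: "sigma_finite_measure half_line"
proof
  have "(\<Union>n::nat. {0..real n}) = {0..}"
    by (auto intro: real_arch_simple)
  moreover have "emeasure half_line {0..real n} \<noteq> \<infinity>" for n
    by (simp add: emeasure_restrict_space)
  ultimately show "\<exists>A. countable A \<and> A \<subseteq> sets half_line \<and> \<Union> A = space half_line \<and> (\<forall>a\<in>A. emeasure half_line a \<noteq> \<infinity>)"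
    by (intro exI[of _ "range (\<lambda>n::nat. {0..real n})"]) (auto simp: sets_restrict_space_iff)
qed

text \<open>This half of the convergence of norms is what Scheffe's lemma asks for. The weighted
  inequality bounds the integral for \<open>F n\<close> by nearly that for \<open>f\<close> plus
  \<open>t powr (1 - p)\<close> times the error. The weight t is fixed before n grows, since for p >
  1 that factor blows up as t tends to 0.\<close>

lemma limsup_nn_integral_powr_le:
  fixes f :: "'a \<Rightarrow> real" and p :: real
  assumes p: "1 \<le> p" and f: "integrable M (\<lambda>x. \<bar>f x\<bar> powr p)"
    and F: "\<And>n. integrable M (\<lambda>x. \<bar>F n x\<bar> powr p)"
    and d: "\<And>n. integrable M (\<lambda>x. \<bar>F n x - f x\<bar> powr p)"
    and lim: "(\<lambda>n. LINT x|M. \<bar>F n x - f x\<bar> powr p) \<longlonglongrightarrow> 0"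
  shows "limsup (\<lambda>n. \<integral>\<^sup>+x. ennreal (\<bar>F n x\<bar> powr p) \<partial>M) \<le> (\<integral>\<^sup>+x. ennreal (\<bar>f x\<bar> powr p) \<partial>M)"
proof -
  define a where "a = (LINT x|M. \<bar>f x\<bar> powr p)"
  define b where "b n = (LINT x|M. \<bar>F n x\<bar> powr p)" for n
  define c where "c n = (LINT x|M. \<bar>F n x - f x\<bar> powr p)" for n
  have b: "b n \<le> (1 - t) powr (1 - p) * a + t powr (1 - p) * c n" if "0 < t" "t < 1" for t n
  proof -
    have "b n \<le> (LINT x|M. (1 - t) powr (1 - p) * \<bar>f x\<bar> powr p + t powr (1 - p) * \<bar>F n x - f x\<bar> powr p)"
      unfolding b_def
    proof (rule integral_mono)
      fix x
      have "\<bar>F n x\<bar> powr p \<le> (\<bar>f x\<bar> + \<bar>F n x - f x\<bar>) powr p"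
        using p by (intro powr_mono2) auto
      also have "\<dots> \<le> (1 - t) powr (1 - p) * \<bar>f x\<bar> powr p + t powr (1 - p) * \<bar>F n x - f x\<bar> powr p"
        using p that by (intro powr_add_le_weighted) auto
      finally show "\<bar>F n x\<bar> powr p \<le> (1 - t) powr (1 - p) * \<bar>f x\<bar> powr p + t powr (1 - p) * \<bar>F n x - f x\<bar> powr p" .
    qed (use F f d in auto)
    also have "\<dots> = (1 - t) powr (1 - p) * a + t powr (1 - p) * c n"
      using f d by (simp add: a_def c_def)
    finally show ?thesis .
  qed
  have "\<forall>\<^sub>F n in sequentially. b n < y" if "a < y" for y
  proof -
    have "((\<lambda>t. (1 - t) powr (1 - p) * a) \<longlongrightarrow> (1 - 0) powr (1 - p) * a) (at_right 0)"
      by (intro tendsto_intros) auto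
    then have "\<forall>\<^sub>F t in at_right 0. (1 - t) powr (1 - p) * a < y"
      using that by (intro order_tendstoD(2)) auto
    moreover have "\<forall>\<^sub>F t in at_right 0. 0 < t \<and> t < (1::real)"
      by (auto simp: eventually_at_right_field intro!: exI[of _ 1])
    ultimately have "\<forall>\<^sub>F t in at_right 0. (1 - t) powr (1 - p) * a < y \<and> 0 < t \<and> t < 1"
      by eventually_elim auto
    then obtain t where t: "(1 - t) powr (1 - p) * a < y" "0 < t" "t < 1"
      using eventually_happens[of _ "at_right (0::real)"] by auto
    have "(\<lambda>n. (1 - t) powr (1 - p) * a + t powr (1 - p) * c n) \<longlonglongrightarrow> (1 - t) powr (1 - p) * a + t powr (1 - p) * 0"
      unfolding c_def by (intro tendsto_intros lim)
    then have "\<forall>\<^sub>F n in sequentially. (1 - t) powr (1 - p) * a + t powr (1 - p) * c n < y"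
      using t by (intro order_tendstoD(2)) auto
    then show ?thesis
      by eventually_elim (use b t in \<open>auto intro: le_less_trans\<close>)
  qed
  note ev = this
  have nn: "0 \<le> b n" "0 \<le> a" for n
    by (auto simp: a_def b_def)
  have "limsup (\<lambda>n. ennreal (b n)) \<le> ennreal a"
  proof (rule Limsup_le_iff[THEN iffD2], safe)
    fix y assume "ennreal a < y"
    then obtain y' where y': "ennreal a < ennreal y'" "ennreal y' < y"
      using ennreal_rat_dense by blast
    then have "a < y'"
      using nn by (simp add: ennreal_less_iff)
    show "\<forall>\<^sub>F n in sequentially. ennreal (b n) < y"
      using ev[OF \<open>a < y'\<close>] by eventually_elim (use y' in \<open>meson ennreal_leI le_less_trans less_imp_le\<close>)
  qed
  moreover have "(\<integral>\<^sup>+x. ennreal (\<bar>F n x\<bar> powr p) \<partial>M) = ennreal (b n)" for n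
    unfolding b_def by (intro nn_integral_eq_integral F) auto
  moreover have "(\<integral>\<^sup>+x. ennreal (\<bar>f x\<bar> powr p) \<partial>M) = ennreal a"
    unfolding a_def by (intro nn_integral_eq_integral f) auto
  ultimately show ?thesis
    by simp
qed

lemma tendsto_integral_powr_diff:
  fixes f :: "'a \<Rightarrow> real" and p :: real
  assumes p: "1 \<le> p" and nn: "\<And>n x. 0 \<le> F n x" "\<And>x. 0 \<le> f x"
    and [measurable]: "\<And>n. F n \<in> borel_measurable M" "f \<in> borel_measurable M"
    and int: "\<And>n. integrable M (\<lambda>x. F n x powr p)" "integrable M (\<lambda>x. f x powr p)"
    and AE: "AE x in M. (\<lambda>n. F n x) \<longlonglongrightarrow> f x"
    and limsup: "limsup (\<lambda>n. \<integral>\<^sup>+x. ennreal (F n x powr p) \<partial>M) \<le> (\<integral>\<^sup>+x. ennreal (f x powr p) \<partial>M)"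
  shows "(\<lambda>n. LINT x|M. \<bar>F n x - f x\<bar> powr p) \<longlonglongrightarrow> 0"
proof -
  have le: "\<bar>F n x - f x\<bar> powr p \<le> \<bar>F n x powr p - f x powr p\<bar>" for n x
    using nn p by (intro powr_abs_diff_le)
  have "(\<lambda>n. \<integral>\<^sup>+x. norm (F n x powr p - f x powr p) \<partial>M) \<longlonglongrightarrow> 0"
  proof (rule Scheffe_lemma1)
    show "AE x in M. (\<lambda>n. F n x powr p) \<longlonglongrightarrow> f x powr p"
      using AE by eventually_elim (use p nn in \<open>auto intro!: tendsto_powr'\<close>)
  qed (use int limsup in auto)
  then have "(\<lambda>n. \<integral>\<^sup>+x. ennreal (\<bar>F n x - f x\<bar> powr p) \<partial>M) \<longlonglongrightarrow> 0"
    by (rule tendsto_sandwich[OF _ _ tendsto_const, rotated 2])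
      (auto intro!: always_eventually nn_integral_mono ennreal_leI le)
  moreover have "(\<integral>\<^sup>+x. ennreal (\<bar>F n x - f x\<bar> powr p) \<partial>M) = ennreal (LINT x|M. \<bar>F n x - f x\<bar> powr p)" for n
  proof (rule nn_integral_eq_integral)
    show "integrable M (\<lambda>x. \<bar>F n x - f x\<bar> powr p)"
      by (rule Bochner_Integration.integrable_bound[of _ "\<lambda>x. \<bar>F n x powr p - f x powr p\<bar>"])
        (use int le in auto)
  qed auto
  ultimately have "(\<lambda>n. ennreal (LINT x|M. \<bar>F n x - f x\<bar> powr p)) \<longlonglongrightarrow> ennreal 0"
    by simp
  then show ?thesis
    by (subst (asm) tendsto_ennreal_iff) auto
qed

section \<open>Superlevel sets, essential infimum and essential convex hull\<close>

lemma superlevel_iff [simp]: "x \<in> superlevel f \<nu> \<longleftrightarrow> 0 \<le> x \<and> \<nu> \<le> f x"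
  by (simp add: superlevel_def)

lemma superlevel_antimono: "\<kappa> \<le> \<nu> \<Longrightarrow> superlevel (f :: real \<Rightarrow> 'a :: preorder) \<nu> \<subseteq> superlevel f \<kappa>"
  by (auto intro: order_trans)

lemma superlevel_measurable [measurable]:
  fixes f :: "real \<Rightarrow> 'a :: {second_countable_topology, linorder_topology}"
  assumes [measurable]: "f \<in> borel_measurable half_line"
  shows "superlevel f \<nu> \<in> sets lebesgue"
proof -
  have "{x \<in> space half_line. \<nu> \<le> f x} \<in> sets half_line"
    by measurable
  then show ?thesis
    by (simp add: superlevel_def sets_restrict_space_iff)
qed

lemma emeasure_half_line: "A \<subseteq> {0..} \<Longrightarrow> emeasure half_line A = emeasure lebesgue A"
  by (simp add: emeasure_restrict_space)

lemma emeasure_half_line_superlevel: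
  "emeasure half_line (superlevel f \<nu>) = emeasure lebesgue (superlevel f \<nu>)"
  by (rule emeasure_half_line) auto

text \<open>The intersection is uncountable, but it is convex, and every real interval is
  Borel.\<close>

lemma ess_conv_measurable [measurable]: "ess_conv A \<in> sets lebesgue"
proof -
  have "convex (ess_conv A)"
    unfolding ess_conv_def by (intro convex_Inter) auto
  then have "ess_conv A \<in> sets borel"
    by (intro real_interval_borel_measurable) (simp add: is_interval_convex_1)
  then show ?thesis
    by simp
qed

text \<open>The supremum need not be attained, so the set is covered by the null sets A \<inter>
  [0,q] with q rational, a countable family.\<close>

lemma inf_ess_null:
  assumes A: "A \<in> sets lebesgue"
  shows "A \<inter> {t. 0 \<le> t \<and> ennreal t < inf_ess A} \<in> null_sets lebesgue"
proof -
  let ?Q = "{q \<in> \<rat>. emeasure lebesgue (A \<inter> {0..q}) = 0}"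
  have "countable ?Q"
    by (rule countable_subset[OF _ countable_rat]) auto
  moreover have "A \<inter> {0..q} \<in> null_sets lebesgue" if "q \<in> ?Q" for q
    using that A by (auto simp: null_sets_def)
  ultimately have N: "(\<Union>q\<in>?Q. A \<inter> {0..q}) \<in> null_sets lebesgue"
    by (intro null_sets_UN') auto
  have "A \<inter> {t. 0 \<le> t \<and> ennreal t < inf_ess A} \<subseteq> (\<Union>q\<in>?Q. A \<inter> {0..q})"
  proof safe
    fix t assume t: "t \<in> A" "0 \<le> t" "ennreal t < inf_ess A"
    then obtain a where a: "0 \<le> a" "emeasure lebesgue (A \<inter> {0..a}) = 0" "ennreal t < ennreal a"
      unfolding inf_ess_def less_Sup_iff by auto
    then obtain q where q: "q \<in> \<rat>" "t < q" "q < a"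
      using Rats_dense_in_real[of t a] t by (auto simp: ennreal_less_iff)
    have "emeasure lebesgue (A \<inter> {0..q}) \<le> emeasure lebesgue (A \<inter> {0..a})"
      using A q by (intro emeasure_mono) auto
    then have "q \<in> ?Q"
      using a q by simp
    then show "t \<in> (\<Union>q\<in>?Q. A \<inter> {0..q})"
      using t q by (intro UN_I[of q]) auto
  qed
  then show ?thesis
    using N A by (intro null_sets_completion_subset[OF _ N])
qed

lemma inf_ess_le:
  assumes A: "A \<in> sets lebesgue" and "emeasure lebesgue (A \<inter> {0..R}) \<noteq> 0"
  shows "inf_ess A \<le> ennreal R"
  unfolding inf_ess_def
proof (rule Sup_least, safe)
  fix a :: real assume a: "0 \<le> a" "emeasure lebesgue (A \<inter> {0..a}) = 0"
  have "emeasure lebesgue (A \<inter> {0..R}) \<le> emeasure lebesgue (A \<inter> {0..a})" if "R \<le> a"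
    using A that by (intro emeasure_mono) auto
  then have "\<not> R \<le> a"
    using a assms by auto
  then show "ennreal a \<le> ennreal R"
    by (simp add: ennreal_leI)
qed

lemma emeasure_pos_of_inf_ess_less:
  assumes "0 \<le> t" "inf_ess A < ennreal t"
  shows "emeasure lebesgue (A \<inter> {0..t}) \<noteq> 0"
  using assms Sup_upper[of "ennreal t" "{ennreal a | a. 0 \<le> a \<and> emeasure lebesgue (A \<inter> {0..a}) = 0}"]
  unfolding inf_ess_def by (auto simp: not_less[symmetric])

lemma inf_ess_antimono:
  assumes "B \<in> sets lebesgue" "A \<subseteq> B"
  shows "inf_ess B \<le> inf_ess A"
  unfolding inf_ess_def
proof (rule Sup_subset_mono, safe)
  fix a :: real assume a: "0 \<le> a" "emeasure lebesgue (B \<inter> {0..a}) = 0"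
  have "emeasure lebesgue (A \<inter> {0..a}) \<le> emeasure lebesgue (B \<inter> {0..a})"
    using assms by (intro emeasure_mono) auto
  then show "\<exists>b. ennreal a = ennreal b \<and> 0 \<le> b \<and> emeasure lebesgue (A \<inter> {0..b}) = 0"
    using a by (intro exI[of _ a]) auto
qed

lemma emeasure_bounded_part_pos:
  assumes A: "A \<in> sets lebesgue" "A \<subseteq> {0..}" and "emeasure lebesgue A \<noteq> 0"
  obtains R :: real where "0 \<le> R" "emeasure lebesgue (A \<inter> {0..R}) \<noteq> 0"
proof (rule ccontr)
  assume *: "\<not> thesis"
  have "A \<inter> {0..real n} \<in> null_sets lebesgue" for n :: nat
    using * that[of "real n"] A by (auto simp: null_sets_def)
  then have "(\<Union>n. A \<inter> {0..real n}) \<in> null_sets lebesgue"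
    by (intro null_sets_UN) auto
  moreover have "(\<Union>n. A \<inter> {0..real n}) = A"
    using A(2) by (auto intro: real_arch_simple)
  ultimately show False
    using assms by auto
qed

lemma inf_ess_finite:
  assumes "A \<in> sets lebesgue" "A \<subseteq> {0..}" "emeasure lebesgue A \<noteq> 0"
  shows "inf_ess A < top"
proof -
  obtain R :: real where "0 \<le> R" "emeasure lebesgue (A \<inter> {0..R}) \<noteq> 0"
    using emeasure_bounded_part_pos[OF assms] .
  then have "inf_ess A \<le> ennreal R"
    using assms by (intro inf_ess_le) auto
  then show ?thesis
    by (rule le_less_trans) simp
qed

text \<open>A set that differs from A by a null set meets every measurable set in which A has
  positive measure. Here these are [0,t] and [t,\<infinity>), and the hull of a point of each
  contains t.\<close>

lemma mem_ess_conv: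
  assumes A: "A \<in> sets lebesgue" and t: "0 \<le> t" "inf_ess A < ennreal t"
    and R: "emeasure lebesgue (A \<inter> {t..}) \<noteq> 0"
  shows "t \<in> ess_conv A"
  unfolding ess_conv_def
proof safe
  fix B assume B: "B \<subseteq> {0..}" "sym_diff A B \<in> null_sets lebesgue"
  have meet: "\<exists>b\<in>B. b \<in> I" if I: "I \<in> sets lebesgue" "emeasure lebesgue (A \<inter> I) \<noteq> 0" for I
  proof (rule ccontr)
    assume "\<not> ?thesis"
    then have "A \<inter> I \<subseteq> sym_diff A B"
      by auto
    then have "A \<inter> I \<in> null_sets lebesgue"
      using B null_sets_completion_subset by blast
    then show False
      using I by auto
  qed
  obtain b where "b \<in> B" "b \<le> t"
    using meet[of "{0..t}"] emeasure_pos_of_inf_ess_less[OF t] by auto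
  moreover obtain c where "c \<in> B" "t \<le> c"
    using meet[of "{t..}"] R by auto
  ultimately show "t \<in> convex hull B"
    by (meson convex_convex_hull hull_inc is_interval_convex_1 mem_is_interval_1_I)
qed

lemma ess_conv_subset: "A \<subseteq> {0..} \<Longrightarrow> ess_conv A \<subseteq> {0..}"
proof -
  assume A: "A \<subseteq> {0..}"
  then have "ess_conv A \<subseteq> convex hull A"
    unfolding ess_conv_def by (intro INF_lower) auto
  also have "\<dots> \<subseteq> {0..}"
    using A by (intro hull_minimal) auto
  finally show ?thesis .
qed

text \<open>If B agrees with A' up to a null set, then B \<inter> A agrees with A, so every hull in
  the intersection for A' contains one from the intersection for A.\<close>

lemma ess_conv_mono:
  assumes "A \<subseteq> A'"
  shows "ess_conv A \<subseteq> ess_conv A'"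
  unfolding ess_conv_def
proof (rule INF_greatest, safe)
  fix B x assume B: "B \<subseteq> {0..}" "sym_diff A' B \<in> null_sets lebesgue"
    and x: "x \<in> (\<Inter>B\<in>{B. B \<subseteq> {0..} \<and> sym_diff A B \<in> null_sets lebesgue}. convex hull B)"
  have "sym_diff A (B \<inter> A) \<subseteq> sym_diff A' B"
    using assms by auto
  then have "sym_diff A (B \<inter> A) \<in> null_sets lebesgue"
    using B null_sets_completion_subset by blast
  then have "x \<in> convex hull (B \<inter> A)"
    using x B by blast
  then show "x \<in> convex hull B"
    using hull_mono[of "B \<inter> A" B convex] by auto
qed

text \<open>Prepares continuity from above along superlevel sets. The case \<nu> =
  \<open>top\<close> is included, where subtracting 1/n would give nothing.\<close>

lemma approx_below:
  fixes \<nu> :: ennreal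
  assumes "0 < \<nu>"
  obtains \<kappa> :: "nat \<Rightarrow> ennreal"
  where "incseq \<kappa>" "\<And>n. 0 < \<kappa> n" "\<And>n. \<kappa> n < \<nu>" "(SUP n. \<kappa> n) = \<nu>"
proof -
  have "{0<..<\<nu>} \<noteq> {}"
    using assms dense by auto
  then obtain \<kappa> :: "nat \<Rightarrow> ennreal"
    where "incseq \<kappa>" "range \<kappa> \<subseteq> {0<..<\<nu>}" "Sup {0<..<\<nu>} = (SUP n. \<kappa> n)"
    using ennreal_Sup_countable_SUP[of "{0<..<\<nu>}"] by auto
  then have "incseq \<kappa>" "0 < \<kappa> n" "\<kappa> n < \<nu>" "(SUP n. \<kappa> n) = \<nu>" for n
    using assms by (auto simp: image_subset_iff)
  then show ?thesis
    by (rule that)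
qed

lemma INF_emeasure_superlevel:
  fixes f :: "real \<Rightarrow> ennreal"
  assumes meas: "\<And>\<mu>. superlevel f \<mu> \<in> sets lebesgue"
    and fin: "\<And>n. emeasure lebesgue (superlevel f (\<kappa> n)) < \<infinity>"
    and "incseq \<kappa>" "(SUP n. \<kappa> n) = \<nu>"
  shows "(INF n. emeasure lebesgue (superlevel f (\<kappa> n))) = emeasure lebesgue (superlevel f \<nu>)"
proof -
  have "superlevel f \<nu> = (\<Inter>n. superlevel f (\<kappa> n))"
    using assms(4) by (auto simp: SUP_le_iff)
  moreover have "decseq (\<lambda>n. superlevel f (\<kappa> n))"
    using assms(3) by (simp add: decseq_def incseq_def superlevel_antimono)
  moreover have "range (\<lambda>n. superlevel f (\<kappa> n)) \<subseteq> sets lebesgue"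
    using meas by auto
  ultimately show ?thesis
    using INF_emeasure_decseq[of "\<lambda>n. superlevel f (\<kappa> n)" lebesgue] fin[THEN less_imp_neq]
    by (auto simp only:)
qed

section \<open>The tamping of one function and its distribution\<close>

locale finite_superlevels =
  fixes u :: "real \<Rightarrow> ennreal"
  assumes meas [measurable]: "u \<in> borel_measurable half_line"
    and fin: "\<And>\<nu>. 0 < \<nu> \<Longrightarrow> emeasure lebesgue (superlevel u \<nu>) < \<infinity>"
begin

lemma sets_superlevel: "superlevel u \<nu> \<in> sets lebesgue"
  by measurable

text \<open>A point x of a hollow at level \<mu> satisfies \<open>u x < \<mu>\<close>. Lowering
  \<mu> to a rational above \<open>u x\<close> keeps x outside the superlevel set and inside the
  essential hull, which can only grow.\<close>

lemma hollows_below_measurable [measurable]: "hollows_below \<nu> u \<in> sets lebesgue"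
proof -
  define Q where "Q = range (\<lambda>q. ennreal (real_of_rat q)) \<inter> {..<\<nu>}"
  have "countable Q"
    unfolding Q_def by (intro countable_Int1) simp
  have "hollows_below \<nu> u = (\<Union>\<mu>\<in>Q. hollows (superlevel u \<mu>))"
  proof (intro equalityI subsetI)
    fix x assume "x \<in> hollows_below \<nu> u"
    then obtain \<mu> where \<mu>: "\<mu> < \<nu>" "x \<in> ess_conv (superlevel u \<mu>)" "x \<notin> superlevel u \<mu>"
      by (auto simp: hollows_below_def hollows_def simp del: superlevel_iff)
    have "superlevel u \<mu> \<subseteq> {0..}"
      by auto
    then have "0 \<le> x"
      using ess_conv_subset \<mu> by auto
    then have "u x < \<mu>"
      using \<mu> by (simp add: not_le)
    then obtain q where q: "u x < ennreal (real_of_rat q)" "ennreal (real_of_rat q) < \<mu>"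
      using ennreal_rat_dense by auto
    have "x \<in> ess_conv (superlevel u (ennreal (real_of_rat q)))"
      using \<mu> q ess_conv_mono[OF superlevel_antimono[OF less_imp_le[OF q(2)], of u]] by blast
    then have "x \<in> hollows (superlevel u (ennreal (real_of_rat q)))"
      using q by (simp add: hollows_def not_le)
    moreover have "ennreal (real_of_rat q) \<in> Q"
      using q \<mu> by (auto simp: Q_def)
    ultimately show "x \<in> (\<Union>\<mu>\<in>Q. hollows (superlevel u \<mu>))"
      by blast
  qed (auto simp: Q_def hollows_below_def)
  also have "\<dots> \<in> sets lebesgue"
    using \<open>countable Q\<close> by (intro sets.countable_UN') (auto simp: hollows_def)
  finally show ?thesis .
qed

lemma tamp_x_finite:
  assumes "emeasure lebesgue (superlevel u \<nu>) \<noteq> 0"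
  obtains X where "0 \<le> X" "tamp_x u \<nu> = ennreal X"
proof -
  have "tamp_x u \<nu> < top"
    unfolding tamp_x_def using assms by (intro inf_ess_finite sets_superlevel) auto
  then show ?thesis
    using that by (cases "tamp_x u \<nu>") auto
qed

text \<open>As the measure of the part of [0,X] outside the hollows, the left endpoint is additive
  in X, and its increments between levels can be computed without truncated subtraction.\<close>

lemma tamp_y_eq:
  assumes "0 \<le> X" "tamp_x u \<nu> = ennreal X"
  shows "tamp_y u \<nu> = emeasure lebesgue ({0..X} - hollows_below top u)"
proof -
  let ?H = "hollows_below top u"
  have "{t. 0 \<le> t \<and> ennreal t \<le> ennreal X} = {0..X}"
    using assms by auto
  then have "tamp_y u \<nu> = emeasure lebesgue {0..X} - emeasure lebesgue (?H \<inter> {0..X})"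
    using assms by (simp add: tamp_y_def)
  also have "\<dots> = emeasure lebesgue ({0..X} - ?H \<inter> {0..X})"
    by (rule emeasure_Diff[symmetric]) (use emeasure_mono[of "?H \<inter> {0..X}" "{0..X}" lebesgue] assms in \<open>auto simp: top_unique\<close>)
  also have "{0..X} - ?H \<inter> {0..X} = {0..X} - ?H"
    by auto
  finally show ?thesis .
qed

lemma tamp_y_le_tamp_x: "tamp_y u \<nu> \<le> tamp_x u \<nu>"
  by (simp add: tamp_y_def)

text \<open>If {u \<ge> \<kappa>} were null beyond t, so would be {u \<ge> \<nu>}, which is also
  null below \<open>tamp_x u \<nu>\<close> > t; then it would be null altogether. So {u \<ge>
  \<kappa>} has mass on both sides of t and its essential hull contains t. The bound
  \<open>\<kappa> < top\<close> is there because \<open>hollows_below top\<close> collects the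
  hollows of finite levels.\<close>

lemma superlevel_of_not_hollow:
  assumes \<nu>: "\<kappa> \<le> \<nu>" "\<kappa> < top" "emeasure lebesgue (superlevel u \<nu>) \<noteq> 0"
    and t: "0 \<le> t" "tamp_x u \<kappa> < ennreal t" "ennreal t < tamp_x u \<nu>"
    and H: "t \<notin> hollows_below top u"
  shows "t \<in> superlevel u \<kappa>"
proof -
  have "emeasure lebesgue (superlevel u \<kappa> \<inter> {t..}) \<noteq> 0"
  proof
    assume "emeasure lebesgue (superlevel u \<kappa> \<inter> {t..}) = 0"
    then have "superlevel u \<kappa> \<inter> {t..} \<in> null_sets lebesgue"
      using sets_superlevel by (intro null_setsI sets.Int) auto
    moreover have "superlevel u \<nu> \<inter> {s. 0 \<le> s \<and> ennreal s < tamp_x u \<nu>} \<in> null_sets lebesgue"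
      unfolding tamp_x_def by (intro inf_ess_null sets_superlevel)
    ultimately have N: "(superlevel u \<kappa> \<inter> {t..}) \<union>
        (superlevel u \<nu> \<inter> {s. 0 \<le> s \<and> ennreal s < tamp_x u \<nu>}) \<in> null_sets lebesgue"
      by (rule null_sets.Un)
    have "s \<ge> t \<or> ennreal s < tamp_x u \<nu>" if "0 \<le> s" for s
      using t that by (metis ennreal_leI le_less_trans linear)
    then have "superlevel u \<nu> \<subseteq> (superlevel u \<kappa> \<inter> {t..}) \<union>
        (superlevel u \<nu> \<inter> {s. 0 \<le> s \<and> ennreal s < tamp_x u \<nu>})"
      using superlevel_antimono[OF \<nu>(1), of u] unfolding superlevel_def by blast
    then have "superlevel u \<nu> \<in> null_sets lebesgue"
      using N null_sets_completion_subset by blast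
    then show False
      using \<nu> by auto
  qed
  then have "t \<in> ess_conv (superlevel u \<kappa>)"
    using t by (intro mem_ess_conv sets_superlevel) (auto simp: tamp_x_def)
  then show ?thesis
    using H \<nu>(2) by (auto simp: hollows_below_def hollows_def simp del: superlevel_iff)
qed

text \<open>From \<kappa> to \<nu> the left endpoint moves right by the measure of the part of (X,Y]
  outside the hollows. Up to a null set this part lies in {u \<ge> \<kappa>} - {u \<ge> \<nu>}, so
  the shift is at most the loss of length and the right endpoint does not advance.\<close>

lemma tamp_endpoints_mono:
  assumes \<kappa>: "0 < \<kappa>" "\<kappa> \<le> \<nu>" and pos: "emeasure lebesgue (superlevel u \<nu>) \<noteq> 0"
  shows "tamp_y u \<kappa> \<le> tamp_y u \<nu>" (is ?left)
    and "tamp_y u \<nu> + emeasure lebesgue (superlevel u \<nu>)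
      \<le> tamp_y u \<kappa> + emeasure lebesgue (superlevel u \<kappa>)" (is ?right)
proof -
  let ?A = "superlevel u" and ?H = "hollows_below top u" and ?m = "emeasure lebesgue"
  have sub: "?A \<nu> \<subseteq> ?A \<kappa>"
    using \<kappa> by (intro superlevel_antimono)
  have "?m (?A \<nu>) \<le> ?m (?A \<kappa>)"
    using sub by (intro emeasure_mono sets_superlevel)
  then have "?m (?A \<kappa>) \<noteq> 0"
    using pos by auto
  then obtain X where X: "0 \<le> X" "tamp_x u \<kappa> = ennreal X"
    by (rule tamp_x_finite)
  obtain Y where Y: "0 \<le> Y" "tamp_x u \<nu> = ennreal Y"
    using pos by (rule tamp_x_finite)
  have "tamp_x u \<kappa> \<le> tamp_x u \<nu>"
    unfolding tamp_x_def using sub by (intro inf_ess_antimono sets_superlevel)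
  then have XY: "X \<le> Y"
    using X Y by simp
  have "?m ({0..Y} - ?H) = ?m (({0..X} - ?H) \<union> ({X<..Y} - ?H))"
    using XY X by (intro arg_cong[of _ _ ?m]) auto
  also have "\<dots> = ?m ({0..X} - ?H) + ?m ({X<..Y} - ?H)"
    by (rule plus_emeasure[symmetric]) auto
  finally have y: "tamp_y u \<nu> = tamp_y u \<kappa> + ?m ({X<..Y} - ?H)"
    using tamp_y_eq[OF X] tamp_y_eq[OF Y] by simp
  then show ?left
    by simp
  have "?m ({X<..Y} - ?H) \<le> ?m (?A \<kappa> - ?A \<nu>)"
  proof (cases "\<kappa> = top")
    \<comment> \<open>Hollows of finite levels say nothing about {u = top}, but here \<nu> =
      \<open>top\<close> as well and the interval between the essential infima is empty.\<close>
    case True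
    then have "X = Y"
      using \<kappa> X Y by (simp add: top_unique)
    then show ?thesis
      by simp
  next
    case False
    \<comment> \<open>The endpoint Y, which is not strictly between the essential infima, and the
      null part of {u \<ge> \<nu>} below its essential infimum.\<close>
    let ?N = "insert Y (?A \<nu> \<inter> {t. 0 \<le> t \<and> ennreal t < tamp_x u \<nu>})"
    have "?A \<nu> \<inter> {t. 0 \<le> t \<and> ennreal t < tamp_x u \<nu>} \<in> null_sets lebesgue"
      unfolding tamp_x_def by (intro inf_ess_null sets_superlevel)
    then have N: "?N \<in> null_sets lebesgue"
      using null_sets.Un[of "{Y}" lebesgue] by auto
    have "{X<..Y} - ?H \<subseteq> (?A \<kappa> - ?A \<nu>) \<union> ?N"
    proof
      fix t assume t: "t \<in> {X<..Y} - ?H"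
      show "t \<in> (?A \<kappa> - ?A \<nu>) \<union> ?N"
      proof (cases "t = Y")
        case False
        then have lt: "X < t" "t < Y"
          using t by auto
        then have "t \<in> ?A \<kappa>"
          using \<kappa> pos \<open>\<kappa> \<noteq> top\<close> t X Y
          by (intro superlevel_of_not_hollow) (auto simp: ennreal_less_iff less_top)
        then show ?thesis
          using lt X Y by (auto simp: ennreal_less_iff)
      qed simp
    qed
    then have "?m ({X<..Y} - ?H) \<le> ?m ((?A \<kappa> - ?A \<nu>) \<union> ?N)"
      using N by (intro emeasure_mono sets.Un sets.Diff null_setsD2[OF N] sets_superlevel)
    also have "\<dots> = ?m (?A \<kappa> - ?A \<nu>)"
      using N sets_superlevel by (intro emeasure_Un_null_set) auto
    finally show ?thesis .
  qed
  then have "tamp_y u \<nu> + ?m (?A \<nu>) \<le> tamp_y u \<kappa> + (?m (?A \<kappa> - ?A \<nu>) + ?m (?A \<nu>))"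
    unfolding y add.assoc by (intro add_mono) auto
  also have "?m (?A \<kappa> - ?A \<nu>) + ?m (?A \<nu>) = ?m ((?A \<kappa> - ?A \<nu>) \<union> ?A \<nu>)"
    using sets_superlevel by (intro plus_emeasure) auto
  also have "(?A \<kappa> - ?A \<nu>) \<union> ?A \<nu> = ?A \<kappa>"
    using sub by auto
  finally show ?right .
qed

lemma tamp_interval_antimono:
  assumes "0 < \<kappa>" "\<kappa> \<le> \<nu>"
  shows "tamp_interval u \<nu> \<subseteq> tamp_interval u \<kappa>"
proof (cases "emeasure lebesgue (superlevel u \<nu>) = 0")
  case False
  have "emeasure lebesgue (superlevel u \<nu>) \<le> emeasure lebesgue (superlevel u \<kappa>)"
    using assms by (intro emeasure_mono superlevel_antimono sets_superlevel)
  then have "emeasure lebesgue (superlevel u \<kappa>) \<noteq> 0"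
    using False by auto
  then show ?thesis
    using False tamp_endpoints_mono[OF assms False]
    by (auto simp: tamp_interval_def intro: order_trans)
qed (simp add: tamp_interval_def)

lemma tamp_interval_eq:
  assumes "0 < \<nu>" "emeasure lebesgue (superlevel u \<nu>) \<noteq> 0"
  obtains a where "0 \<le> a" "ennreal a \<le> tamp_x u \<nu>"
    "tamp_interval u \<nu> = {a..a + measure lebesgue (superlevel u \<nu>)}"
proof -
  obtain X where X: "0 \<le> X" "tamp_x u \<nu> = ennreal X"
    using assms(2) by (rule tamp_x_finite)
  have "tamp_y u \<nu> < top"
    using tamp_y_le_tamp_x[of \<nu>] X by (auto simp: le_less_trans)
  then obtain a where a: "0 \<le> a" "tamp_y u \<nu> = ennreal a"
    by (cases "tamp_y u \<nu>") auto
  have m: "emeasure lebesgue (superlevel u \<nu>) = ennreal (measure lebesgue (superlevel u \<nu>))"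
    using fin[OF assms(1)] by (intro emeasure_eq_ennreal_measure) auto
  have "tamp_interval u \<nu> = {a..a + measure lebesgue (superlevel u \<nu>)}"
    unfolding tamp_interval_def using a assms(2)
    by (auto simp: m simp flip: ennreal_plus)
  then show ?thesis
    using that[of a] a tamp_y_le_tamp_x[of \<nu>] by simp
qed

lemma tamp_interval_measurable: "0 < \<nu> \<Longrightarrow> tamp_interval u \<nu> \<in> sets lebesgue"
  by (cases "emeasure lebesgue (superlevel u \<nu>) = 0")
    (simp add: tamp_interval_def, metis tamp_interval_eq atLeastAtMost_borel sets_completionI_sets sets_lborel)

lemma convex_tamp_interval: "0 < \<nu> \<Longrightarrow> convex (tamp_interval u \<nu>)"
  by (cases "emeasure lebesgue (superlevel u \<nu>) = 0")
    (simp add: tamp_interval_def, metis tamp_interval_eq convex_real_interval(5))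

lemma emeasure_tamp_interval:
  assumes "0 < \<nu>"
  shows "emeasure lebesgue (tamp_interval u \<nu>) = emeasure lebesgue (superlevel u \<nu>)"
proof (cases "emeasure lebesgue (superlevel u \<nu>) = 0")
  case False
  then obtain a where "tamp_interval u \<nu> = {a..a + measure lebesgue (superlevel u \<nu>)}"
    using tamp_interval_eq[OF assms] by metis
  then have "emeasure lebesgue (tamp_interval u \<nu>) = ennreal (measure lebesgue (superlevel u \<nu>))"
    by simp
  also have "\<dots> = emeasure lebesgue (superlevel u \<nu>)"
    using fin[OF assms] by (intro emeasure_eq_ennreal_measure[symmetric]) auto
  finally show ?thesis .
qed (simp add: tamp_interval_def)

text \<open>The supremum need not be attained, so lower levels are intersected; where {u \<ge>
  \<nu>} is null, the result can be a single point although \<open>tamp_interval u \<nu>\<close> is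
  empty. Nesting lets a level \<mu> > \<kappa> whose interval contains x be lowered to
  \<kappa>.\<close>

lemma superlevel_tamping:
  assumes "0 < \<nu>"
  shows "superlevel (tamping u) \<nu> = (\<Inter>\<kappa>\<in>{0<..<\<nu>}. tamp_interval u \<kappa>)"
proof (intro equalityI subsetI INT_I)
  fix x \<kappa> assume x: "x \<in> superlevel (tamping u) \<nu>" and \<kappa>: "\<kappa> \<in> {0<..<\<nu>}"
  then have "\<kappa> < tamping u x"
    by auto
  then obtain \<mu> where "\<kappa> < \<mu>" "x \<in> tamp_interval u \<mu>"
    unfolding tamping_def less_Sup_iff by auto
  then show "x \<in> tamp_interval u \<kappa>"
    using tamp_interval_antimono[of \<kappa> \<mu>] \<kappa> by (auto dest: less_imp_le)
next
  fix x assume x: "x \<in> (\<Inter>\<kappa>\<in>{0<..<\<nu>}. tamp_interval u \<kappa>)"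
  have "\<nu> \<le> tamping u x"
  proof (rule dense_le)
    fix y assume "y < \<nu>"
    then obtain \<kappa> where \<kappa>: "y < \<kappa>" "\<kappa> < \<nu>"
      using dense by blast
    then have "0 < \<kappa>" "\<kappa> < top"
      by (auto intro: le_less_trans less_le_trans)
    then have "\<kappa> \<le> tamping u x"
      unfolding tamping_def using x \<kappa> by (intro Sup_upper) auto
    then show "y \<le> tamping u x"
      using \<kappa> by simp
  qed
  moreover obtain \<kappa> where "\<kappa> \<in> {0<..<\<nu>}"
    using dense[OF assms] by auto
  then have "x \<in> tamp_interval u \<kappa>"
    using x by blast
  then have "0 \<le> x"
    by (auto simp: tamp_interval_def split: if_splits)
  ultimately show "x \<in> superlevel (tamping u) \<nu>"
    by simp
qed

lemma convex_superlevel_tamping: "0 < \<nu> \<Longrightarrow> convex (superlevel (tamping u) \<nu>)"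
  by (auto simp: superlevel_tamping intro!: convex_INT convex_tamp_interval)

lemma superlevel_tamping_measurable: "superlevel (tamping u) \<nu> \<in> sets lebesgue"
proof (cases "0 < \<nu>")
  case True
  then have "superlevel (tamping u) \<nu> \<in> sets borel"
    using convex_superlevel_tamping
    by (intro real_interval_borel_measurable) (simp add: is_interval_convex_1)
  then show ?thesis
    by simp
next
  case False
  then have "superlevel (tamping u) \<nu> = {0..}"
    by auto
  then show ?thesis
    by simp
qed

lemma tamping_measurable [measurable]: "tamping u \<in> borel_measurable half_line"
proof (rule borel_measurableI_ge)
  fix \<nu>
  have "{x \<in> space half_line. \<nu> \<le> tamping u x} = superlevel (tamping u) \<nu>"
    by auto
  then show "{x \<in> space half_line. \<nu> \<le> tamping u x} \<in> sets half_line"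
    using superlevel_tamping_measurable by (auto simp: sets_restrict_space_iff)
qed

text \<open>The intervals of lower levels have the measures of the corresponding superlevel sets of
  u. Continuity from above along one sequence of levels, applied to both families, gives equality at
  every positive level and not only almost every one.\<close>

lemma emeasure_superlevel_tamping:
  assumes "0 < \<nu>"
  shows "emeasure lebesgue (superlevel (tamping u) \<nu>) = emeasure lebesgue (superlevel u \<nu>)"
proof -
  obtain \<kappa> where \<kappa>: "incseq \<kappa>" "\<And>n. 0 < \<kappa> n" "\<And>n. \<kappa> n < \<nu>" "(SUP n. \<kappa> n) = \<nu>"
    using approx_below[OF assms] by blast
  have above: "\<exists>n. y < \<kappa> n" if "y < \<nu>" for y
    using that unfolding \<kappa>(4)[symmetric] less_SUP_iff by auto
  have "superlevel (tamping u) \<nu> = (\<Inter>n. tamp_interval u (\<kappa> n))"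
  proof -
    have "(\<Inter>n. tamp_interval u (\<kappa> n)) \<subseteq> tamp_interval u y" if y: "y \<in> {0<..<\<nu>}" for y
    proof -
      obtain n where "y < \<kappa> n"
        using above[of y] y by auto
      then have "tamp_interval u (\<kappa> n) \<subseteq> tamp_interval u y"
        using y by (intro tamp_interval_antimono) auto
      then show ?thesis
        by blast
    qed
    moreover have "\<kappa> n \<in> {0<..<\<nu>}" for n
      using \<kappa> by auto
    ultimately show ?thesis
      unfolding superlevel_tamping[OF assms] by blast
  qed
  also have "emeasure lebesgue \<dots> = (INF n. emeasure lebesgue (tamp_interval u (\<kappa> n)))"
  proof (rule INF_emeasure_decseq[symmetric])
    show "range (\<lambda>n. tamp_interval u (\<kappa> n)) \<subseteq> sets lebesgue"
      using tamp_interval_measurable[OF \<kappa>(2)] by auto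
    show "decseq (\<lambda>n. tamp_interval u (\<kappa> n))"
      unfolding decseq_def using tamp_interval_antimono[OF \<kappa>(2)] incseqD[OF \<kappa>(1)] by blast
    show "emeasure lebesgue (tamp_interval u (\<kappa> n)) \<noteq> \<infinity>" for n
      using fin[OF \<kappa>(2), of n] emeasure_tamp_interval[OF \<kappa>(2), of n] by auto
  qed
  also have "\<dots> = (INF n. emeasure lebesgue (superlevel u (\<kappa> n)))"
    by (simp only: emeasure_tamp_interval[OF \<kappa>(2)])
  also have "\<dots> = emeasure lebesgue (superlevel u \<nu>)"
    using \<kappa> fin[OF \<kappa>(2)] by (intro INF_emeasure_superlevel sets_superlevel)
  finally show ?thesis .
qed

text \<open>The interval at level \<kappa> starts no later than the essential infimum of {u \<ge>
  \<kappa>}, hence no later than R once this set has mass in [0,R]. The level drops from \<nu> to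
  \<kappa> because the superlevel set is an intersection over strictly lower levels.\<close>

lemma superlevel_tamping_subset:
  assumes "0 < \<kappa>" "\<kappa> < \<nu>" "emeasure lebesgue (superlevel u \<kappa> \<inter> {0..R}) \<noteq> 0"
  shows "superlevel (tamping u) \<nu> \<subseteq> {0..R + measure lebesgue (superlevel u \<kappa>)}"
proof -
  have "emeasure lebesgue (superlevel u \<kappa> \<inter> {0..R}) \<le> emeasure lebesgue (superlevel u \<kappa>)"
    by (intro emeasure_mono sets_superlevel) auto
  then have "emeasure lebesgue (superlevel u \<kappa>) \<noteq> 0"
    using assms(3) by auto
  then obtain a where a: "0 \<le> a" "ennreal a \<le> tamp_x u \<kappa>"
    "tamp_interval u \<kappa> = {a..a + measure lebesgue (superlevel u \<kappa>)}"
    using tamp_interval_eq[OF assms(1)] by metis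
  have "tamp_x u \<kappa> \<le> ennreal R"
    unfolding tamp_x_def using assms by (intro inf_ess_le sets_superlevel)
  then have "ennreal a \<le> ennreal R"
    using a by simp
  moreover have "0 \<le> R"
    using assms(3) by (rule_tac ccontr) simp
  ultimately have "a \<le> R"
    by (simp add: ennreal_le_iff)
  have "superlevel (tamping u) \<nu> \<subseteq> tamp_interval u \<kappa>"
    using assms superlevel_tamping[of \<nu>] by auto
  then show ?thesis
    using a \<open>a \<le> R\<close> by auto
qed

end

section \<open>Compactness for functions whose superlevel sets are intervals\<close>

text \<open>An interval is determined up to two points by its endpoints, which range in the compact
  space [0,\<infinity>]. Once both endpoints converge, only a point equal to one of the limits can
  remain undecided.\<close>

lemma convex_sets_subseq:
  fixes I :: "nat \<Rightarrow> real set"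
  assumes conv: "\<And>n. convex (I n)" and pos: "\<And>n. I n \<subseteq> {0..}"
  shows "\<exists>r N. strict_mono r \<and> countable N \<and>
    (\<forall>x. 0 \<le> x \<longrightarrow> x \<notin> N \<longrightarrow>
      (\<forall>\<^sub>F n in sequentially. x \<in> I (r n)) \<or> (\<forall>\<^sub>F n in sequentially. x \<notin> I (r n)))"
proof -
  \<comment> \<open>An empty \<open>I n\<close> gets a n = \<open>top\<close> and b n = 0, which is
    consistent with the two facts that follow.\<close>
  define a b where "a n = Inf (ennreal ` I n)" and "b n = Sup (ennreal ` I n)" for n
  have inside: "x \<in> I n" if x: "0 \<le> x" "a n < ennreal x" "ennreal x < b n" for x n
  proof -
    obtain y where y: "y \<in> I n" "ennreal y < ennreal x"
      using x unfolding a_def Inf_less_iff by auto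
    then have "y < x"
      using pos[of n] by (auto simp: ennreal_less_iff)
    moreover obtain z where "z \<in> I n" "x < z"
      using x unfolding b_def less_Sup_iff by (auto simp: ennreal_less_iff)
    ultimately show ?thesis
      using conv[of n] y(1) by (meson is_interval_convex_1 less_imp_le mem_is_interval_1_I)
  qed
  have outside: "a n \<le> ennreal x \<and> ennreal x \<le> b n" if "x \<in> I n" for x n
    using that by (auto simp: a_def b_def intro: Inf_lower Sup_upper)
  obtain r1 \<alpha> where r1: "strict_mono r1" "(\<lambda>n. a (r1 n)) \<longlonglongrightarrow> \<alpha>"
    using compact_complete_linorder[of a] by (auto simp: o_def)
  obtain r2 \<beta> where r2: "strict_mono r2" "(\<lambda>n. b (r1 (r2 n))) \<longlonglongrightarrow> \<beta>"
    using compact_complete_linorder[of "\<lambda>n. b (r1 n)"] by (auto simp: o_def)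
  define r where "r n = r1 (r2 n)" for n
  have r: "strict_mono r"
    using strict_mono_o[OF r1(1) r2(1)] by (simp add: r_def[abs_def] o_def)
  have a: "(\<lambda>n. a (r n)) \<longlonglongrightarrow> \<alpha>" and b: "(\<lambda>n. b (r n)) \<longlonglongrightarrow> \<beta>"
    using LIMSEQ_subseq_LIMSEQ[OF r1(2) r2(1)] r2(2) by (auto simp: r_def o_def)
  have "(\<forall>\<^sub>F n in sequentially. x \<in> I (r n)) \<or> (\<forall>\<^sub>F n in sequentially. x \<notin> I (r n))"
    if x: "0 \<le> x" "x \<notin> {enn2real \<alpha>, enn2real \<beta>}" for x
  proof -
    \<comment> \<open>If a limit is \<open>top\<close>, \<open>enn2real\<close> turns it into 0,
      which only adds 0 to the exceptional points.\<close>
    have "ennreal x \<noteq> \<alpha>" "ennreal x \<noteq> \<beta>"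
      using x by auto
    then consider "ennreal x < \<alpha>" | "\<beta> < ennreal x" | "\<alpha> < ennreal x" "ennreal x < \<beta>"
      by (meson linorder_neqE)
    then show ?thesis
    proof cases
      case 1
      then have "\<forall>\<^sub>F n in sequentially. ennreal x < a (r n)"
        using a by (intro order_tendstoD)
      then have "\<forall>\<^sub>F n in sequentially. x \<notin> I (r n)"
        by eventually_elim (use outside in \<open>auto simp: not_le[symmetric]\<close>)
      then show ?thesis ..
    next
      case 2
      then have "\<forall>\<^sub>F n in sequentially. b (r n) < ennreal x"
        using b by (intro order_tendstoD)
      then have "\<forall>\<^sub>F n in sequentially. x \<notin> I (r n)"
        by eventually_elim (use outside in \<open>auto simp: not_le[symmetric]\<close>)
      then show ?thesis ..
    next
      case 3
      then have "\<forall>\<^sub>F n in sequentially. a (r n) < ennreal x" "\<forall>\<^sub>F n in sequentially. ennreal x < b (r n)"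
        using a b by (auto intro: order_tendstoD)
      then have "\<forall>\<^sub>F n in sequentially. x \<in> I (r n)"
        by eventually_elim (use x inside in auto)
      then show ?thesis ..
    qed
  qed
  then show ?thesis
    using r by (intro exI[of _ r] exI[of _ "{enn2real \<alpha>, enn2real \<beta>}"]) auto
qed

text \<open>A Helly selection principle for functions whose superlevel sets are intervals.\<close>

lemma convex_superlevels_subseq:
  fixes f :: "nat \<Rightarrow> real \<Rightarrow> ennreal"
  assumes conv: "\<And>n \<nu>. convex (superlevel (f n) \<nu>)"
  obtains r N where "strict_mono r" "countable N"
    "\<And>x. 0 \<le> x \<Longrightarrow> x \<notin> N \<Longrightarrow> (\<lambda>n. f (r n) x) \<longlonglongrightarrow> liminf (\<lambda>n. f (r n) x)"
proof -
  \<comment> \<open>An enumeration of the rational levels; negative rationals become level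
    0.\<close>
  define q :: "nat \<Rightarrow> ennreal" where "q k = ennreal (real_of_rat (from_nat k))" for k
  \<comment> \<open>Level \<open>q k\<close> is decided along r outside a countable set: eventually
    reached or eventually missed. This passes to further subsequences, as a diagonal extraction
    demands.\<close>
  define P where "P k r \<longleftrightarrow> (\<exists>N. countable N \<and> (\<forall>x. 0 \<le> x \<longrightarrow> x \<notin> N \<longrightarrow>
      (\<forall>\<^sub>F n in sequentially. q k \<le> f (r n) x) \<or> (\<forall>\<^sub>F n in sequentially. f (r n) x < q k)))"
    for k and r :: "nat \<Rightarrow> nat"
  interpret subseqs P
  proof
    fix k and s :: "nat \<Rightarrow> nat"
    have *: "convex (superlevel (f (s n)) (q k))" "superlevel (f (s n)) (q k) \<subseteq> {0..}" for n
      using conv by auto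
    from convex_sets_subseq[of "\<lambda>n. superlevel (f (s n)) (q k)", OF *] obtain r N where r: "strict_mono r" "countable N"
      "\<forall>x. 0 \<le> x \<longrightarrow> x \<notin> N \<longrightarrow> (\<forall>\<^sub>F n in sequentially. x \<in> superlevel (f (s (r n))) (q k)) \<or>
        (\<forall>\<^sub>F n in sequentially. x \<notin> superlevel (f (s (r n))) (q k))"
      by (elim exE conjE)
    have "P k (s \<circ> r)"
      unfolding P_def using r(2,3) by (intro exI[of _ N]) (simp add: not_le)
    with r(1) show "\<exists>r. strict_mono r \<and> P k (s \<circ> r)"
      by (intro exI[of _ r] conjI)
  qed
  define d where "d = diagseq"
  have "P k d" for k
  proof -
    \<comment> \<open>The property of stage k is available for the diagonal sequence from index
      \<open>Suc k\<close> on; being eventual, it does not depend on the terms before.\<close>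
    have "P k (diagseq \<circ> (+) (Suc k))"
    proof (rule diagseq_holds)
      fix r s :: "nat \<Rightarrow> nat" and n assume r: "strict_mono r" and "P n s"
      then obtain N where N: "countable N" "\<And>x. 0 \<le> x \<Longrightarrow> x \<notin> N \<Longrightarrow>
          (\<forall>\<^sub>F m in sequentially. q n \<le> f (s m) x) \<or> (\<forall>\<^sub>F m in sequentially. f (s m) x < q n)"
        unfolding P_def by blast
      have "(\<forall>\<^sub>F m in sequentially. q n \<le> f (s (r m)) x) \<or>
          (\<forall>\<^sub>F m in sequentially. f (s (r m)) x < q n)" if "0 \<le> x" "x \<notin> N" for x
        using N(2)[OF that] eventually_subseq[OF r, of "\<lambda>m. q n \<le> f (s m) x"]
          eventually_subseq[OF r, of "\<lambda>m. f (s m) x < q n"] by auto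
      then show "P n (s \<circ> r)"
        unfolding P_def o_def using N(1) by (intro exI[of _ N] conjI allI impI)
    qed
    then have "P k (\<lambda>n. d (n + Suc k))"
      by (simp add: d_def o_def add.commute)
    then obtain N where N: "countable N" "\<And>x. 0 \<le> x \<Longrightarrow> x \<notin> N \<Longrightarrow>
        (\<forall>\<^sub>F n in sequentially. q k \<le> f (d (n + Suc k)) x) \<or>
        (\<forall>\<^sub>F n in sequentially. f (d (n + Suc k)) x < q k)"
      unfolding P_def by blast
    have "(\<forall>\<^sub>F n in sequentially. q k \<le> f (d n) x) \<or>
        (\<forall>\<^sub>F n in sequentially. f (d n) x < q k)" if "0 \<le> x" "x \<notin> N" for x
      using N(2)[OF that] eventually_sequentially_seg[of "\<lambda>n. q k \<le> f (d n) x" "Suc k"]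
        eventually_sequentially_seg[of "\<lambda>n. f (d n) x < q k" "Suc k"] by blast
    then show ?thesis
      unfolding P_def using N(1) by (intro exI[of _ N] conjI allI impI)
  qed
  then have ex: "\<exists>N. countable N \<and> (\<forall>x. 0 \<le> x \<longrightarrow> x \<notin> N \<longrightarrow>
      (\<forall>\<^sub>F n in sequentially. q k \<le> f (d n) x) \<or>
      (\<forall>\<^sub>F n in sequentially. f (d n) x < q k))" for k
    unfolding P_def .
  define N where "N k = (SOME N. countable N \<and> (\<forall>x. 0 \<le> x \<longrightarrow> x \<notin> N \<longrightarrow>
      (\<forall>\<^sub>F n in sequentially. q k \<le> f (d n) x) \<or>
      (\<forall>\<^sub>F n in sequentially. f (d n) x < q k)))" for k
  have N: "countable (N k) \<and> (\<forall>x. 0 \<le> x \<longrightarrow> x \<notin> N k \<longrightarrow>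
      (\<forall>\<^sub>F n in sequentially. q k \<le> f (d n) x) \<or> (\<forall>\<^sub>F n in sequentially. f (d n) x < q k))" for k
    unfolding N_def by (rule someI_ex) (rule ex)
  show ?thesis
  proof
    show "strict_mono d"
      unfolding d_def by (rule subseq_diagseq)
    show "countable (\<Union>k. N k)"
      using N by auto
    fix x :: real assume x: "0 \<le> x" "x \<notin> (\<Union>k. N k)"
    let ?X = "\<lambda>n. f (d n) x"
    \<comment> \<open>Otherwise a rational level strictly between the two limits would be undecided
      at x.\<close>
    have "limsup ?X \<le> liminf ?X"
    proof (rule ccontr)
      assume "\<not> limsup ?X \<le> liminf ?X"
      then obtain c where c: "liminf ?X < ennreal (real_of_rat c)" "ennreal (real_of_rat c) < limsup ?X"
        using ennreal_rat_dense by (auto simp: not_le)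
      obtain k where "c = from_nat k"
        using surjD[OF surj_from_nat] by blast
      then have k: "q k = ennreal (real_of_rat c)"
        by (simp add: q_def)
      have "x \<notin> N k"
        using x by auto
      then consider "\<forall>\<^sub>F n in sequentially. q k \<le> ?X n" | "\<forall>\<^sub>F n in sequentially. ?X n < q k"
        using N[of k] x(1) by blast
      then show False
      proof cases
        case 1
        then have "q k \<le> liminf ?X"
          by (rule Liminf_bounded)
        then show False
          using c k by simp
      next
        case 2
        then have "\<forall>\<^sub>F n in sequentially. ?X n \<le> q k"
          by eventually_elim simp
        then have "limsup ?X \<le> q k"
          by (rule Limsup_bounded)
        then show False
          using c k by simp
      qed
    qed
    then show "?X \<longlonglongrightarrow> liminf ?X"
      using Liminf_le_Limsup[of sequentially ?X] by (intro Liminf_eq_Limsup) auto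
  qed
qed

section \<open>The distribution of a limit of tampings\<close>

text \<open>Limits yield comparisons between strictly different levels. Letting the lower level
  increase to \<nu> closes the gap by continuity from above; the finiteness this requires of f is
  inherited from g through \<open>fg\<close>.\<close>

lemma emeasure_superlevel_eqI:
  fixes f g :: "real \<Rightarrow> ennreal"
  assumes f: "\<And>\<mu>. superlevel f \<mu> \<in> sets lebesgue" and g: "\<And>\<mu>. superlevel g \<mu> \<in> sets lebesgue"
    and fin: "\<And>\<mu>. 0 < \<mu> \<Longrightarrow> emeasure lebesgue (superlevel g \<mu>) < \<infinity>"
    and fg: "\<And>\<kappa> \<mu>. 0 < \<kappa> \<Longrightarrow> \<kappa> < \<mu> \<Longrightarrow>
      emeasure lebesgue (superlevel f \<mu>) \<le> emeasure lebesgue (superlevel g \<kappa>)"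
    and gf: "\<And>\<kappa> \<mu>. 0 < \<kappa> \<Longrightarrow> \<kappa> < \<mu> \<Longrightarrow>
      emeasure lebesgue (superlevel g \<mu>) \<le> emeasure lebesgue (superlevel f \<kappa>)"
    and \<nu>: "0 < \<nu>"
  shows "emeasure lebesgue (superlevel f \<nu>) = emeasure lebesgue (superlevel g \<nu>)"
proof -
  obtain \<kappa> where \<kappa>: "incseq \<kappa>" "\<And>n. 0 < \<kappa> n" "\<And>n. \<kappa> n < \<nu>" "(SUP n. \<kappa> n) = \<nu>"
    using approx_below[OF \<nu>] by blast
  have fin': "emeasure lebesgue (superlevel f \<mu>) < \<infinity>" if "0 < \<mu>" for \<mu>
  proof -
    obtain \<kappa> where "0 < \<kappa>" "\<kappa> < \<mu>"
      using \<open>0 < \<mu>\<close> dense by blast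
    then show ?thesis
      using fg fin by (meson le_less_trans)
  qed
  have "emeasure lebesgue (superlevel f \<nu>) \<le> (INF n. emeasure lebesgue (superlevel g (\<kappa> n)))"
    by (intro INF_greatest fg \<kappa>)
  moreover have "emeasure lebesgue (superlevel g \<nu>) \<le> (INF n. emeasure lebesgue (superlevel f (\<kappa> n)))"
    by (intro INF_greatest gf \<kappa>)
  ultimately show ?thesis
    using INF_emeasure_superlevel[OF f fin'[OF \<kappa>(2)] \<kappa>(1,4)] INF_emeasure_superlevel[OF g fin[OF \<kappa>(2)] \<kappa>(1,4)]
    by (intro antisym) auto
qed

text \<open>Fatou's lemma for indicators. The level drops because convergence to a value \<ge> \<nu>
  only yields \<open>F n x > \<kappa>\<close> eventually.\<close>

lemma emeasure_superlevel_le_liminf: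
  fixes F :: "nat \<Rightarrow> real \<Rightarrow> ennreal"
  assumes [measurable]: "\<And>n. F n \<in> borel_measurable half_line" "f \<in> borel_measurable half_line"
    and lim: "AE x in half_line. (\<lambda>n. F n x) \<longlonglongrightarrow> f x" and "\<kappa> < \<nu>"
  shows "emeasure lebesgue (superlevel f \<nu>) \<le> liminf (\<lambda>n. emeasure lebesgue (superlevel (F n) \<kappa>))"
proof -
  have S: "superlevel g \<mu> \<in> sets half_line" if "g \<in> borel_measurable half_line" for g :: "real \<Rightarrow> ennreal" and \<mu>
    using that by (auto simp: sets_restrict_space_iff)
  have "(\<integral>\<^sup>+x. indicator (superlevel f \<nu>) x \<partial>half_line)
      \<le> (\<integral>\<^sup>+x. liminf (\<lambda>n. indicator (superlevel (F n) \<kappa>) x) \<partial>half_line)"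
  proof (rule nn_integral_mono_AE)
    show "AE x in half_line. indicator (superlevel f \<nu>) x
        \<le> liminf (\<lambda>n. indicator (superlevel (F n) \<kappa>) x :: ennreal)"
      using lim
    proof eventually_elim
      case (elim x)
      show ?case
      proof (cases "x \<in> superlevel f \<nu>")
        case True
        then have "\<forall>\<^sub>F n in sequentially. \<kappa> < F n x"
          using \<open>\<kappa> < \<nu>\<close> by (intro order_tendstoD(1)[OF elim]) auto
        then show ?thesis
          by (intro Liminf_bounded, eventually_elim) (use True in \<open>simp add: indicator_def\<close>)
      qed simp
    qed
  qed
  also have "\<dots> \<le> liminf (\<lambda>n. \<integral>\<^sup>+x. indicator (superlevel (F n) \<kappa>) x \<partial>half_line)"
    using S by (intro nn_integral_liminf) auto
  finally show ?thesis
    using S by (simp add: emeasure_half_line_superlevel)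
qed

text \<open>The reverse Fatou lemma, dominated by the indicator of [0,K]; without such a bound mass
  could escape to infinity. No level is lost, as \<open>f x < \<nu>\<close> is an open
  condition.\<close>

lemma limsup_le_emeasure_superlevel:
  fixes F :: "nat \<Rightarrow> real \<Rightarrow> ennreal"
  assumes [measurable]: "\<And>n. F n \<in> borel_measurable half_line" "f \<in> borel_measurable half_line"
    and lim: "AE x in half_line. (\<lambda>n. F n x) \<longlonglongrightarrow> f x"
    and K: "\<And>n. superlevel (F n) \<nu> \<subseteq> {0..K}"
  shows "limsup (\<lambda>n. emeasure lebesgue (superlevel (F n) \<nu>)) \<le> emeasure lebesgue (superlevel f \<nu>)"
proof -
  have S: "superlevel g \<mu> \<in> sets half_line" if "g \<in> borel_measurable half_line" for g :: "real \<Rightarrow> ennreal" and \<mu>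
    using that by (auto simp: sets_restrict_space_iff)
  have Ks: "{0..K} \<in> sets half_line"
    by (auto simp: sets_restrict_space_iff)
  have "limsup (\<lambda>n. \<integral>\<^sup>+x. indicator (superlevel (F n) \<nu>) x \<partial>half_line)
      \<le> (\<integral>\<^sup>+x. limsup (\<lambda>n. indicator (superlevel (F n) \<nu>) x) \<partial>half_line)"
  proof (rule nn_integral_limsup)
    show "(\<integral>\<^sup>+x. indicator {0..K} x \<partial>half_line) < \<infinity>"
      using Ks by (simp add: emeasure_half_line emeasure_lborel_Icc_eq)
    show "AE x in half_line. indicator (superlevel (F n) \<nu>) x \<le> (indicator {0..K} x :: ennreal)" for n
      using K[of n] by (intro AE_I2) (auto simp: indicator_def simp del: superlevel_iff)
  qed (use S Ks in auto)
  also have "\<dots> \<le> (\<integral>\<^sup>+x. indicator (superlevel f \<nu>) x \<partial>half_line)"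
  proof (rule nn_integral_mono_AE)
    show "AE x in half_line. limsup (\<lambda>n. indicator (superlevel (F n) \<nu>) x :: ennreal)
        \<le> indicator (superlevel f \<nu>) x"
      using lim
    proof eventually_elim
      case (elim x)
      show ?case
      proof (cases "x \<in> superlevel f \<nu>")
        case True
        then show ?thesis
          by (intro Limsup_bounded always_eventually) (simp add: indicator_def)
      next
        case False
        have "\<forall>\<^sub>F n in sequentially. x \<notin> superlevel (F n) \<nu>"
        proof (cases "0 \<le> x")
          case True
          then have "\<forall>\<^sub>F n in sequentially. F n x < \<nu>"
            using False by (intro order_tendstoD(2)[OF elim]) auto
          then show ?thesis
            by eventually_elim auto
        qed simp
        then have "\<forall>\<^sub>F n in sequentially.
            indicator (superlevel (F n) \<nu>) x \<le> (indicator (superlevel f \<nu>) x :: ennreal)"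
          by eventually_elim (simp del: superlevel_iff)
        then show ?thesis
          by (rule Limsup_bounded)
      qed
    qed
  qed
  finally show ?thesis
    using S by (simp add: emeasure_half_line_superlevel)
qed

lemma le_limsup_of_le_add:
  fixes X \<delta> :: "nat \<Rightarrow> ennreal"
  assumes le: "\<And>n. a \<le> X n + \<delta> n" and \<delta>: "\<delta> \<longlonglongrightarrow> 0"
  shows "a \<le> limsup X"
proof (rule ccontr)
  assume "\<not> a \<le> limsup X"
  then obtain c where c: "limsup X < c" "c < a"
    using dense by (auto simp: not_le)
  have "\<forall>\<^sub>F n in sequentially. X n < c"
    using c(1) by (rule Limsup_lessD)
  then have "\<forall>\<^sub>F n in sequentially. a \<le> c + \<delta> n"
    by eventually_elim (use le in \<open>meson add_right_mono less_imp_le order_trans\<close>)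
  moreover have "(\<lambda>n. c + \<delta> n) \<longlonglongrightarrow> c + 0"
    by (intro tendsto_add tendsto_const \<delta>)
  ultimately have "a \<le> c"
    using tendsto_lowerbound[of "\<lambda>n. c + \<delta> n" c sequentially a] by simp
  then show False
    using c by simp
qed

lemma liminf_le_of_le_add:
  fixes X \<delta> :: "nat \<Rightarrow> ennreal"
  assumes le: "\<And>n. X n \<le> b + \<delta> n" and \<delta>: "\<delta> \<longlonglongrightarrow> 0"
  shows "liminf X \<le> b"
proof -
  have "(\<lambda>n. b + \<delta> n) \<longlonglongrightarrow> b + 0"
    by (intro tendsto_add tendsto_const \<delta>)
  then have "liminf (\<lambda>n. b + \<delta> n) = b"
    by (simp add: lim_imp_Liminf)
  moreover have "liminf X \<le> liminf (\<lambda>n. b + \<delta> n)"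
    using le by (intro Liminf_mono always_eventually) simp
  ultimately show ?thesis
    by simp
qed

text \<open>Hypothesis \<open>meas\<close> expresses convergence in measure of \<open>U n\<close> to \<open>u\<close>. The inclusion
  of \<open>superlevel (tamping (U n)) \<kappa>\<close> in a bounded interval independent of \<open>n\<close> is what prevents
  the tampings from losing mass at infinity.\<close>

lemma emeasure_superlevel_lim_tamping:
  fixes U :: "nat \<Rightarrow> real \<Rightarrow> ennreal"
  assumes U: "\<And>n. finite_superlevels (U n)" and u: "finite_superlevels u" and top: "\<And>x. u x < top"
    and f [measurable]: "f \<in> borel_measurable half_line"
    and lim: "AE x in half_line. (\<lambda>n. tamping (U n) x) \<longlonglongrightarrow> f x"
    and meas: "\<And>\<kappa> \<nu>. 0 < \<kappa> \<Longrightarrow> \<kappa> < \<nu> \<Longrightarrow> \<nu> < top \<Longrightarrow>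
      \<exists>\<delta> :: nat \<Rightarrow> ennreal. \<delta> \<longlonglongrightarrow> 0 \<and> (\<forall>n. \<forall>B \<in> sets lebesgue.
        emeasure lebesgue (superlevel u \<nu> \<inter> B) \<le> emeasure lebesgue (superlevel (U n) \<kappa> \<inter> B) + \<delta> n \<and>
        emeasure lebesgue (superlevel (U n) \<nu> \<inter> B) \<le> emeasure lebesgue (superlevel u \<kappa> \<inter> B) + \<delta> n)"
    and \<nu>: "0 < \<nu>"
  shows "emeasure lebesgue (superlevel f \<nu>) = emeasure lebesgue (superlevel u \<nu>)"
proof (rule emeasure_superlevel_eqI[OF _ _ _ _ _ \<nu>])
  let ?m = "emeasure lebesgue"
  interpret U: finite_superlevels "U n" for n
    by (rule U)
  interpret u: finite_superlevels u
    by (rule u)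
  show "superlevel f \<mu> \<in> sets lebesgue" "superlevel u \<mu> \<in> sets lebesgue" for \<mu>
    by measurable
  show "?m (superlevel u \<mu>) < \<infinity>" if "0 < \<mu>" for \<mu>
    using u.fin[OF that] .
  have tamp: "?m (superlevel (tamping (U n)) \<mu>) = ?m (superlevel (U n) \<mu>)" if "0 < \<mu>" for n \<mu>
    using U.emeasure_superlevel_tamping[OF that] .
  have UNIV: "UNIV \<in> sets lebesgue" and Icc: "{0..R} \<in> sets lebesgue" for R :: real
    by auto
  fix \<kappa> \<mu> :: ennreal assume \<kappa>: "0 < \<kappa>" "\<kappa> < \<mu>"
  show "?m (superlevel f \<mu>) \<le> ?m (superlevel u \<kappa>)"
  proof -
    \<comment> \<open>The level is lowered twice: from \<mu> to \<kappa>' by Fatou's lemma, and from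
      \<kappa>' to \<kappa> when \<open>U n\<close> is replaced by u.\<close>
    obtain \<kappa>' where \<kappa>': "\<kappa> < \<kappa>'" "\<kappa>' < \<mu>"
      using \<kappa> dense by blast
    have fin: "\<kappa>' < top"
      using \<kappa>'(2) by (rule less_le_trans) simp
    obtain \<delta> where \<delta>: "\<delta> \<longlonglongrightarrow> 0"
      "\<And>n. ?m (superlevel (U n) \<kappa>' \<inter> UNIV) \<le> ?m (superlevel u \<kappa> \<inter> UNIV) + \<delta> n"
      using meas[OF \<kappa>(1) \<kappa>'(1) fin] UNIV by blast
    have "0 < \<kappa>'"
      using \<kappa> \<kappa>' by order
    have "?m (superlevel f \<mu>) \<le> liminf (\<lambda>n. ?m (superlevel (tamping (U n)) \<kappa>'))"
      using \<kappa>'(2) by (intro emeasure_superlevel_le_liminf lim) measurable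
    also have "\<dots> \<le> ?m (superlevel u \<kappa>)"
      using \<delta> by (intro liminf_le_of_le_add[of _ _ \<delta>]) (auto simp: tamp[OF \<open>0 < \<kappa>'\<close>])
    finally show ?thesis .
  qed
  show "?m (superlevel u \<mu>) \<le> ?m (superlevel f \<kappa>)"
  proof (cases "\<mu> = top \<or> ?m (superlevel u \<mu>) = 0")
    case True
    \<comment> \<open>Hypothesis \<open>meas\<close> compares finite levels; finiteness of u
      disposes of level \<open>top\<close>.\<close>
    have "superlevel u top = {}"
      using top by (auto simp: superlevel_def top_unique less_top)
    then show ?thesis
      using True by auto
  next
    case False
    then have fin: "\<mu> < top" and pos: "?m (superlevel u \<mu>) \<noteq> 0"
      by (auto simp: less_top)
    \<comment> \<open>Two lower levels confine the superlevel sets at \<kappa>: it lies in the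
      tamping interval of level \<open>\<kappa>0\<close>, whose length is bounded through {u \<ge>
      \<open>\<kappa>1\<close>}, a set independent of n.\<close>
    obtain \<kappa>0 where \<kappa>0: "0 < \<kappa>0" "\<kappa>0 < \<kappa>"
      using \<kappa>(1) dense by blast
    obtain \<kappa>1 where \<kappa>1: "0 < \<kappa>1" "\<kappa>1 < \<kappa>0"
      using \<kappa>0(1) dense by blast
    have less: "\<kappa>0 < \<mu>" "\<kappa>0 < top"
      using \<kappa> \<kappa>0 fin by order+
    have "superlevel u \<mu> \<subseteq> {0..}"
      by auto
    then obtain R where R: "0 \<le> R" "?m (superlevel u \<mu> \<inter> {0..R}) \<noteq> 0"
      using emeasure_bounded_part_pos[OF u.sets_superlevel _ pos] by blast
    \<comment> \<open>Localised to [0,R], the estimate eventually gives \<open>U n\<close> positive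
      mass there at level \<open>\<kappa>0\<close>, which controls where its tamping interval
      starts.\<close>
    obtain \<delta>0 where \<delta>0: "\<delta>0 \<longlonglongrightarrow> 0"
      "\<And>n. ?m (superlevel u \<mu> \<inter> {0..R}) \<le> ?m (superlevel (U n) \<kappa>0 \<inter> {0..R}) + \<delta>0 n"
      using meas[OF \<kappa>0(1) less(1) fin] Icc by blast
    obtain \<delta>1 where \<delta>1: "\<delta>1 \<longlonglongrightarrow> 0"
      "\<And>n. ?m (superlevel (U n) \<kappa>0 \<inter> UNIV) \<le> ?m (superlevel u \<kappa>1 \<inter> UNIV) + \<delta>1 n"
      using meas[OF \<kappa>1(1) \<kappa>1(2) less(2)] UNIV by blast
    obtain \<delta>2 where \<delta>2: "\<delta>2 \<longlonglongrightarrow> 0"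
      "\<And>n. ?m (superlevel u \<mu> \<inter> UNIV) \<le> ?m (superlevel (U n) \<kappa> \<inter> UNIV) + \<delta>2 n"
      using meas[OF \<kappa> fin] UNIV by blast
    \<comment> \<open>R bounds the left endpoint and the other term the length; the summand 1
      absorbs \<open>\<delta>1 n\<close>.\<close>
    define K where "K = R + enn2real (?m (superlevel u \<kappa>1) + 1)"
    have "\<forall>\<^sub>F n in sequentially. \<delta>0 n < ?m (superlevel u \<mu> \<inter> {0..R})"
      using R by (intro order_tendstoD(2)[OF \<delta>0(1)]) (simp add: zero_less_iff_neq_zero)
    moreover have "\<forall>\<^sub>F n in sequentially. \<delta>1 n < 1"
      by (intro order_tendstoD(2)[OF \<delta>1(1)]) simp
    ultimately have "\<forall>\<^sub>F n in sequentially. superlevel (tamping (U n)) \<kappa> \<subseteq> {0..K}"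
    proof eventually_elim
      case (elim n)
      have "?m (superlevel (U n) \<kappa>0 \<inter> {0..R}) \<noteq> 0"
        using \<delta>0(2)[of n] elim(1) by auto
      then have sub: "superlevel (tamping (U n)) \<kappa> \<subseteq> {0..R + measure lebesgue (superlevel (U n) \<kappa>0)}"
        using \<kappa>0 by (intro U.superlevel_tamping_subset)
      have "?m (superlevel (U n) \<kappa>0) \<le> ?m (superlevel u \<kappa>1) + \<delta>1 n"
        using \<delta>1(2)[of n] by simp
      also have "\<dots> \<le> ?m (superlevel u \<kappa>1) + 1"
        using elim(2) by (intro add_left_mono) simp
      finally have "measure lebesgue (superlevel (U n) \<kappa>0) \<le> enn2real (?m (superlevel u \<kappa>1) + 1)"
        using u.fin[OF \<kappa>1(1)] unfolding Sigma_Algebra.measure_def by (intro enn2real_mono) auto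
      then show ?case
        using sub by (auto simp: K_def simp del: superlevel_iff)
    qed
    then obtain N where N: "\<And>n. N \<le> n \<Longrightarrow> superlevel (tamping (U n)) \<kappa> \<subseteq> {0..K}"
      by (auto simp: eventually_sequentially)
    \<comment> \<open>The inclusion holds from N on, whereas domination is required of every term;
      hence the shift.\<close>
    have "AE x in half_line. (\<lambda>n. tamping (U (n + N)) x) \<longlonglongrightarrow> f x"
      using lim by eventually_elim (rule LIMSEQ_ignore_initial_segment)
    then have "limsup (\<lambda>n. ?m (superlevel (tamping (U (n + N))) \<kappa>)) \<le> ?m (superlevel f \<kappa>)"
      using N by (intro limsup_le_emeasure_superlevel[of _ _ _ K]) auto
    moreover have "?m (superlevel u \<mu>) \<le> limsup (\<lambda>n. ?m (superlevel (tamping (U (n + N))) \<kappa>))"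
      using \<delta>2 by (intro le_limsup_of_le_add[of _ _ "\<lambda>n. \<delta>2 (n + N)"])
        (auto simp: tamp[OF \<kappa>(1)] intro: LIMSEQ_ignore_initial_segment)
    ultimately show ?thesis
      by simp
  qed
qed

section \<open>L^p functions, convergence in measure and equimeasurability\<close>

lemma superlevel_ennreal:
  "0 < r \<Longrightarrow> superlevel (\<lambda>x. ennreal (f x)) (ennreal r) = superlevel f r"
  by (auto simp: superlevel_def ennreal_le_iff2)

lemma LpD:
  assumes "f \<in> Lp p"
  shows "f \<in> borel_measurable half_line" "integrable half_line (\<lambda>x. \<bar>f x\<bar> powr p)"
  using assms by (auto simp: Lp_def)

lemma Lp_diff:
  assumes "f \<in> Lp p" "g \<in> Lp p" "1 \<le> p"
  shows "(\<lambda>x. f x - g x) \<in> Lp p"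
proof -
  note [measurable] = LpD(1)[OF assms(1)] LpD(1)[OF assms(2)]
  \<comment> \<open>The common coefficient of the weighted inequality at t = 1/2.\<close>
  let ?c = "(1 / 2) powr (1 - p)"
  have "integrable half_line (\<lambda>x. \<bar>f x - g x\<bar> powr p)"
  proof (rule Bochner_Integration.integrable_bound)
    show "integrable half_line (\<lambda>x. ?c * \<bar>f x\<bar> powr p + ?c * \<bar>g x\<bar> powr p)"
      using assms by (auto simp: Lp_def)
    have "\<bar>f x - g x\<bar> powr p \<le> ?c * \<bar>f x\<bar> powr p + ?c * \<bar>g x\<bar> powr p" for x
    proof -
      have "\<bar>f x - g x\<bar> powr p \<le> (\<bar>f x\<bar> + \<bar>g x\<bar>) powr p"
        using assms by (intro powr_mono2) auto
      also have "\<dots> \<le> ?c * \<bar>f x\<bar> powr p + ?c * \<bar>g x\<bar> powr p"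
        using powr_add_le_weighted[of p "1 / 2" "\<bar>f x\<bar>" "\<bar>g x\<bar>"] assms by simp
      finally show ?thesis .
    qed
    then show "AE x in half_line. norm (\<bar>f x - g x\<bar> powr p)
        \<le> norm (?c * \<bar>f x\<bar> powr p + ?c * \<bar>g x\<bar> powr p)"
      by simp
  qed measurable
  then show ?thesis
    by (simp add: Lp_def)
qed

lemma Lp_mono:
  assumes g: "g \<in> Lp p" and "0 \<le> p" and [measurable]: "f \<in> borel_measurable half_line"
    and le: "\<And>x. \<bar>f x\<bar> \<le> \<bar>g x\<bar>"
  shows "f \<in> Lp p" and "(LINT x|half_line. \<bar>f x\<bar> powr p) \<le> (LINT x|half_line. \<bar>g x\<bar> powr p)"
proof -
  have *: "\<bar>f x\<bar> powr p \<le> \<bar>g x\<bar> powr p" for x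
    using assms(2) le by (intro powr_mono2) auto
  have int: "integrable half_line (\<lambda>x. \<bar>f x\<bar> powr p)"
    using * by (intro Bochner_Integration.integrable_bound[OF LpD(2)[OF g]]) auto
  then show "f \<in> Lp p"
    by (simp add: Lp_def)
  show "(LINT x|half_line. \<bar>f x\<bar> powr p) \<le> (LINT x|half_line. \<bar>g x\<bar> powr p)"
    using int * by (intro integral_mono LpD(2)[OF g])
qed

lemma Lp_max_0:
  assumes f: "f \<in> Lp p" and "0 \<le> p"
  shows "(\<lambda>x. max 0 (f x)) \<in> Lp p"
proof (rule Lp_mono(1)[OF assms])
  show "(\<lambda>x. max 0 (f x)) \<in> borel_measurable half_line"
    using LpD(1)[OF f] by measurable
qed auto

text \<open>Markov's inequality for the p-th power. It makes superlevel sets finite in measure and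
  turns L^p convergence into convergence in measure.\<close>

lemma emeasure_superlevel_abs_le:
  assumes f: "f \<in> Lp p" and "0 < p" "0 < \<epsilon>"
  shows "emeasure lebesgue (superlevel (\<lambda>x. \<bar>f x\<bar>) \<epsilon>)
    \<le> ennreal (1 / \<epsilon> powr p * (LINT x|half_line. \<bar>f x\<bar> powr p))"
proof -
  have "superlevel (\<lambda>x. \<bar>f x\<bar>) \<epsilon> \<subseteq> {x \<in> space half_line. \<epsilon> powr p \<le> \<bar>f x\<bar> powr p}"
    using assms by (auto intro!: powr_mono2)
  then have "emeasure half_line (superlevel (\<lambda>x. \<bar>f x\<bar>) \<epsilon>)
      \<le> emeasure half_line {x \<in> space half_line. \<epsilon> powr p \<le> \<bar>f x\<bar> powr p}"
    using LpD(1)[OF f] by (intro emeasure_mono) measurable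
  also have "\<dots> \<le> ennreal (1 / \<epsilon> powr p * (LINT x|half_line. \<bar>f x\<bar> powr p))"
    using assms by (intro integral_Markov_inequality LpD(2)[OF f]) auto
  finally show ?thesis
    by (simp add: emeasure_half_line_superlevel)
qed

lemma finite_superlevels_Lp:
  assumes f: "f \<in> Lp p" and "0 < p"
  shows "finite_superlevels (\<lambda>x. ennreal (f x))"
proof
  note [measurable] = LpD(1)[OF f]
  show "(\<lambda>x. ennreal (f x)) \<in> borel_measurable half_line"
    by measurable
  fix \<nu> :: ennreal assume "0 < \<nu>"
  show "emeasure lebesgue (superlevel (\<lambda>x. ennreal (f x)) \<nu>) < \<infinity>"
  proof (cases \<nu>)
    case (real r)
    then have r: "0 < r"
      using \<open>0 < \<nu>\<close> by auto
    have "emeasure lebesgue (superlevel f r) \<le> emeasure lebesgue (superlevel (\<lambda>x. \<bar>f x\<bar>) r)"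
      by (intro emeasure_mono superlevel_measurable) auto
    also have "\<dots> < \<infinity>"
      using emeasure_superlevel_abs_le[OF f \<open>0 < p\<close> r] by (rule le_less_trans) simp
    finally show ?thesis
      using r real by (simp add: superlevel_ennreal)
  next
    case top
    then have "superlevel (\<lambda>x. ennreal (f x)) \<nu> = {}"
      by (auto simp: superlevel_def top_unique)
    then show ?thesis
      by simp
  qed
qed

text \<open>Where one function is at least r and the other below s, they differ by more than r - s.
  The exceptional set depends neither on B nor on the direction of the comparison, so one sequence
  serves for all.\<close>

lemma Lp_lim_superlevels:
  assumes F: "\<And>n. F n \<in> Lp p" and f: "f \<in> Lp p" and p: "1 \<le> p"
    and lim: "(\<lambda>n. LINT x|half_line. \<bar>F n x - f x\<bar> powr p) \<longlonglongrightarrow> 0"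
    and \<nu>: "0 < \<kappa>" "\<kappa> < \<nu>" "\<nu> < top"
  shows "\<exists>\<delta> :: nat \<Rightarrow> ennreal. \<delta> \<longlonglongrightarrow> 0 \<and> (\<forall>n. \<forall>B \<in> sets lebesgue.
    emeasure lebesgue (superlevel (\<lambda>x. ennreal (f x)) \<nu> \<inter> B)
      \<le> emeasure lebesgue (superlevel (\<lambda>x. ennreal (F n x)) \<kappa> \<inter> B) + \<delta> n \<and>
    emeasure lebesgue (superlevel (\<lambda>x. ennreal (F n x)) \<nu> \<inter> B)
      \<le> emeasure lebesgue (superlevel (\<lambda>x. ennreal (f x)) \<kappa> \<inter> B) + \<delta> n)"
proof -
  obtain r where r: "\<nu> = ennreal r" "0 \<le> r"
    using \<nu>(3) by (cases \<nu>) auto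
  obtain s where s: "\<kappa> = ennreal s" "0 \<le> s"
    using \<nu>(2,3) by (cases \<kappa>) auto
  have sr: "0 < s" "s < r"
    using \<nu> r s by (auto simp: ennreal_less_iff)
  note [measurable] = LpD(1)[OF f] LpD(1)[OF F]
  define c where "c n = 1 / (r - s) powr p * (LINT x|half_line. \<bar>F n x - f x\<bar> powr p)" for n
  have c: "emeasure lebesgue (superlevel (\<lambda>x. \<bar>F n x - f x\<bar>) (r - s)) \<le> ennreal (c n)" for n
    unfolding c_def using p sr by (intro emeasure_superlevel_abs_le Lp_diff F f) auto
  have "c \<longlonglongrightarrow> 1 / (r - s) powr p * 0"
    unfolding c_def by (intro tendsto_intros lim)
  then have "(\<lambda>n. ennreal (c n)) \<longlonglongrightarrow> 0"
    using tendsto_ennrealI[of c 0] by simp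
  moreover have "emeasure lebesgue (superlevel g r \<inter> B) \<le> emeasure lebesgue (superlevel h s \<inter> B) + ennreal (c n)"
    if [measurable]: "g \<in> borel_measurable half_line" "h \<in> borel_measurable half_line" "B \<in> sets lebesgue"
      and gh: "\<And>x. \<bar>F n x - f x\<bar> = \<bar>g x - h x\<bar>" for g h B n
  proof -
    have "emeasure lebesgue (superlevel g r \<inter> B)
        \<le> emeasure lebesgue ((superlevel h s \<inter> B) \<union> superlevel (\<lambda>x. \<bar>F n x - f x\<bar>) (r - s))"
      unfolding gh by (intro emeasure_mono) auto
    also have "\<dots> \<le> emeasure lebesgue (superlevel h s \<inter> B)
        + emeasure lebesgue (superlevel (\<lambda>x. \<bar>F n x - f x\<bar>) (r - s))"
      by (intro emeasure_subadditive) measurable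
    also have "\<dots> \<le> emeasure lebesgue (superlevel h s \<inter> B) + ennreal (c n)"
      using c by (intro add_left_mono)
    finally show ?thesis .
  qed
  ultimately show ?thesis
    using sr r s by (intro exI[of _ "\<lambda>n. ennreal (c n)"]) (auto simp: superlevel_ennreal abs_minus_commute)
qed

text \<open>Serves both for the tampings and for their limit, which take values in
  \<open>ennreal\<close>. The hypothesis at \<nu> = \<open>top\<close>, where the superlevel set of
  a real function is empty, makes f finite almost everywhere, so \<open>enn2real\<close> loses
  information on a null set only.\<close>

lemma Lp_equimeasurable:
  fixes f :: "real \<Rightarrow> ennreal"
  assumes [measurable]: "f \<in> borel_measurable half_line"
    and g: "g \<in> Lp p" "\<And>x. 0 \<le> g x" and p: "0 < p"
    and eq: "\<forall>\<nu>>0.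
      emeasure lebesgue (superlevel f \<nu>) = emeasure lebesgue (superlevel (\<lambda>x. ennreal (g x)) \<nu>)"
  shows "AE x in half_line. f x < top"
    and "\<And>\<nu>. 0 < \<nu> \<Longrightarrow> emeasure lebesgue (superlevel (\<lambda>x. enn2real (f x)) \<nu>) = emeasure lebesgue (superlevel g \<nu>)"
    and "(\<integral>\<^sup>+x. ennreal (enn2real (f x) powr p) \<partial>half_line) = (\<integral>\<^sup>+x. ennreal (g x powr p) \<partial>half_line)"
    and "(\<lambda>x. enn2real (f x)) \<in> Lp p"
proof -
  note [measurable] = LpD(1)[OF g(1)]
  have superlevel_eq: "{x \<in> space half_line. \<nu> \<le> h x} = superlevel h \<nu>" for h and \<nu> :: "'a::ord"
    by (auto simp: superlevel_def)
  have "superlevel (\<lambda>x. ennreal (g x)) top = {}"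
    by (auto simp: superlevel_def top_unique)
  then have "emeasure half_line (superlevel f top) = 0"
    using eq[rule_format, of top] by (simp add: emeasure_half_line_superlevel del: emeasure_completion)
  then have "emeasure half_line {x \<in> space half_line. \<not> f x < top} = 0"
    by (simp only: not_less superlevel_eq)
  then show fin: "AE x in half_line. f x < top"
    by (rule AE_I[OF order_refl]) measurable
  show *: "emeasure lebesgue (superlevel (\<lambda>x. enn2real (f x)) \<nu>) = emeasure lebesgue (superlevel g \<nu>)"
    if \<nu>: "0 < \<nu>" for \<nu> :: real
  proof -
    have "emeasure half_line {x \<in> space half_line. \<nu> \<le> enn2real (f x)}
        = emeasure half_line {x \<in> space half_line. ennreal \<nu> \<le> f x}"
    proof (rule emeasure_eq_AE)
      show "AE x in half_line. x \<in> {x \<in> space half_line. \<nu> \<le> enn2real (f x)}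
          \<longleftrightarrow> x \<in> {x \<in> space half_line. ennreal \<nu> \<le> f x}"
        using fin
      proof eventually_elim
        case (elim x)
        then show ?case
          by (cases "f x") (use \<nu> in \<open>auto simp: ennreal_le_iff\<close>)
      qed
    qed measurable
    then show ?thesis
      unfolding superlevel_eq emeasure_half_line_superlevel
      using eq[rule_format, of "ennreal \<nu>"] \<nu> by (simp add: superlevel_ennreal del: emeasure_completion)
  qed
  have "emeasure half_line {x \<in> space half_line. \<nu> \<le> enn2real (f x)}
      = emeasure half_line {x \<in> space half_line. \<nu> \<le> g x}" if "0 < \<nu>" for \<nu>
    unfolding superlevel_eq emeasure_half_line_superlevel using *[OF that] .
  then show int: "(\<integral>\<^sup>+x. ennreal (enn2real (f x) powr p) \<partial>half_line) = (\<integral>\<^sup>+x. ennreal (g x powr p) \<partial>half_line)"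
    using g p by (intro nn_integral_powr_equimeasurable sigma_finite_half_line) auto
  have "(\<integral>\<^sup>+x. ennreal (g x powr p) \<partial>half_line) < \<infinity>"
    using LpD(2)[OF g(1)] g(2) by (simp add: integrable_iff_bounded)
  then have "integrable half_line (\<lambda>x. enn2real (f x) powr p)"
    using int by (simp add: integrable_iff_bounded)
  then show "(\<lambda>x. enn2real (f x)) \<in> Lp p"
    by (simp add: Lp_def)
qed

lemma tendsto_Lp_norm_0_iff:
  assumes "0 < p"
  shows "(\<lambda>n. Lp_norm p (F n)) \<longlonglongrightarrow> 0 \<longleftrightarrow> (\<lambda>n. LINT x|half_line. \<bar>F n x\<bar> powr p) \<longlonglongrightarrow> 0"
proof
  have nn: "0 \<le> (LINT x|half_line. \<bar>F n x\<bar> powr p)" for n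
    by (rule integral_nonneg_AE) simp
  have eq: "(LINT x|half_line. \<bar>F n x\<bar> powr p) = Lp_norm p (F n) powr p" for n
    using assms nn[of n] by (simp add: Lp_norm_def powr_powr)
  show "(\<lambda>n. LINT x|half_line. \<bar>F n x\<bar> powr p) \<longlonglongrightarrow> 0" if "(\<lambda>n. Lp_norm p (F n)) \<longlonglongrightarrow> 0"
    unfolding eq using tendsto_powr'[OF that tendsto_const[of p]] assms by (simp add: Lp_norm_def)
  show "(\<lambda>n. Lp_norm p (F n)) \<longlonglongrightarrow> 0" if "(\<lambda>n. LINT x|half_line. \<bar>F n x\<bar> powr p) \<longlonglongrightarrow> 0"
    unfolding Lp_norm_def using tendsto_powr'[OF that tendsto_const[of "1 / p"]] assms nn by simp
qed

section \<open>Convergence of the tampings in L^p\<close>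

theorem corollary3p9:
  fixes p :: real
    and \<phi>s :: "nat \<Rightarrow> real \<Rightarrow> real"
    and \<phi> :: "real \<Rightarrow> real"
  assumes "1 \<le> p"
    and "\<And>n. \<phi>s n \<in> Lp p"
    and "\<And>n. AE x in half_line. 0 \<le> \<phi>s n x"
    and "\<phi> \<in> Lp p"
    and "(\<lambda>n. Lp_norm p (\<lambda>x. \<phi>s n x - \<phi> x)) \<longlonglongrightarrow> 0"
  shows "\<exists>(r :: nat \<Rightarrow> nat) (\<psi> :: real \<Rightarrow> real).
    strict_mono r \<and>
    (\<forall>n. (AE x in half_line. tamping (\<lambda>t. ennreal (\<phi>s (r n) t)) x < top) \<and>
         (\<lambda>x. enn2real (tamping (\<lambda>t. ennreal (\<phi>s (r n) t)) x)) \<in> Lp p) \<and>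
    \<psi> \<in> Lp p \<and>
    (\<lambda>n. Lp_norm p (\<lambda>x. enn2real (tamping (\<lambda>t. ennreal (\<phi>s (r n) t)) x) - \<psi> x))
      \<longlonglongrightarrow> 0 \<and>
    (\<forall>\<nu>>0. emeasure lebesgue (superlevel \<psi> \<nu>) = emeasure lebesgue (superlevel \<phi> \<nu>))"
proof -
  have p: "0 < p" "1 \<le> p"
    using assms(1) by auto
  \<comment> \<open>Positive parts are non-negative at every point. As \<open>ennreal\<close> sends
    negative reals to 0, the tampings stay the same functions; superlevel sets at positive levels
    are unchanged, and distances do not grow since \<open>max 0\<close> is 1-Lipschitz.\<close>
  define f where "f x = max 0 (\<phi> x)" for x
  define F where "F n x = max 0 (\<phi>s n x)" for n x
  have f: "f \<in> Lp p" "\<And>x. 0 \<le> f x" and F: "\<And>n. F n \<in> Lp p" "\<And>n x. 0 \<le> F n x"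
    using assms p by (auto simp: f_def[abs_def] F_def[abs_def] intro!: Lp_max_0)
  note [measurable] = LpD(1)[OF f(1)] LpD(1)[OF F(1)]
  define U where "U n x = ennreal (F n x)" for n x
  have U_eq: "(\<lambda>t. ennreal (\<phi>s n t)) = U n" for n
    by (auto simp: U_def F_def max_def ennreal_neg)
  have lim: "(\<lambda>n. LINT x|half_line. \<bar>F n x - f x\<bar> powr p) \<longlonglongrightarrow> 0"
  proof (rule tendsto_sandwich[OF _ _ tendsto_const])
    show "(\<lambda>n. LINT x|half_line. \<bar>\<phi>s n x - \<phi> x\<bar> powr p) \<longlonglongrightarrow> 0"
      using assms(5) by (simp add: tendsto_Lp_norm_0_iff[OF p(1)])
    show "\<forall>\<^sub>F n in sequentially. (LINT x|half_line. \<bar>F n x - f x\<bar> powr p) \<le> (LINT x|half_line. \<bar>\<phi>s n x - \<phi> x\<bar> powr p)"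
    proof (intro always_eventually allI Lp_mono(2)[OF Lp_diff[OF assms(2,4,1)]])
      show "\<bar>F n x - f x\<bar> \<le> \<bar>\<phi>s n x - \<phi> x\<bar>" for n x
        by (auto simp: F_def f_def)
    qed (use p in auto)
  qed auto
  have U: "finite_superlevels (U n)" for n
    unfolding U_def[abs_def] by (rule finite_superlevels_Lp[OF F(1) p(1)])
  interpret U: finite_superlevels "U n" for n
    by (rule U)
  \<comment> \<open>The selection principle also asks for level 0, whose superlevel set is the
    half-line.\<close>
  have "convex (superlevel (tamping (U n)) \<nu>)" for n \<nu>
  proof (cases "0 < \<nu>")
    case False
    then have "superlevel (tamping (U n)) \<nu> = {0..}"
      by auto
    then show ?thesis
      by simp
  qed (rule U.convex_superlevel_tamping)
  then obtain r N where r: "strict_mono r" and N: "countable N"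
    and conv: "\<And>x. 0 \<le> x \<Longrightarrow> x \<notin> N \<Longrightarrow>
      (\<lambda>n. tamping (U (r n)) x) \<longlonglongrightarrow> liminf (\<lambda>n. tamping (U (r n)) x)"
    using convex_superlevels_subseq[of "\<lambda>n. tamping (U n)"] by blast
  \<comment> \<open>The lower limit exists everywhere and is measurable; on the half-line it is the
    limit outside N.\<close>
  define g where "g x = liminf (\<lambda>n. tamping (U (r n)) x)" for x
  have g [measurable]: "g \<in> borel_measurable half_line"
    unfolding g_def[abs_def] by measurable
  have "N \<inter> {0..} \<in> null_sets half_line"
    using N by (auto simp: null_sets_restrict_space intro!: countable_imp_null_set_lborel null_sets_completionI countable_Int1)
  then have gAE: "AE x in half_line. (\<lambda>n. tamping (U (r n)) x) \<longlonglongrightarrow> g x"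
    by (rule AE_I') (use conv in \<open>auto simp: g_def\<close>)
  have lim_r: "(\<lambda>n. LINT x|half_line. \<bar>F (r n) x - f x\<bar> powr p) \<longlonglongrightarrow> 0"
    using LIMSEQ_subseq_LIMSEQ[OF lim r] by (simp add: o_def)
  have g_superlevel: "\<forall>\<nu>>0. emeasure lebesgue (superlevel g \<nu>) = emeasure lebesgue (superlevel (\<lambda>x. ennreal (f x)) \<nu>)"
  proof (intro allI impI emeasure_superlevel_lim_tamping[OF U finite_superlevels_Lp[OF f(1) p(1)] _ g gAE])
    show "\<exists>\<delta> :: nat \<Rightarrow> ennreal. \<delta> \<longlonglongrightarrow> 0 \<and> (\<forall>n. \<forall>B \<in> sets lebesgue.
      emeasure lebesgue (superlevel (\<lambda>x. ennreal (f x)) \<mu> \<inter> B)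
        \<le> emeasure lebesgue (superlevel (U (r n)) \<kappa> \<inter> B) + \<delta> n \<and>
      emeasure lebesgue (superlevel (U (r n)) \<mu> \<inter> B)
        \<le> emeasure lebesgue (superlevel (\<lambda>x. ennreal (f x)) \<kappa> \<inter> B) + \<delta> n)"
      if "0 < \<kappa>" "\<kappa> < \<mu>" "\<mu> < top" for \<kappa> \<mu>
      unfolding U_def[abs_def] by (rule Lp_lim_superlevels[OF F(1) f(1) p(2) lim_r that])
  qed simp
  have "\<forall>\<nu>>0. emeasure lebesgue (superlevel (tamping (U n)) \<nu>) = emeasure lebesgue (superlevel (\<lambda>x. ennreal (F n x)) \<nu>)" for n
    using U.emeasure_superlevel_tamping unfolding U_def[abs_def] by blast
  note T = Lp_equimeasurable[OF U.tamping_measurable F p(1) this]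
  note G = Lp_equimeasurable[OF g f p(1) g_superlevel]
  define \<psi> where "\<psi> x = enn2real (g x)" for x
  have "(\<lambda>n. LINT x|half_line. \<bar>enn2real (tamping (U (r n)) x) - \<psi> x\<bar> powr p) \<longlonglongrightarrow> 0"
  proof (rule tendsto_integral_powr_diff[OF p(2)])
    show "AE x in half_line. (\<lambda>n. enn2real (tamping (U (r n)) x)) \<longlonglongrightarrow> \<psi> x"
      using gAE G(1) unfolding \<psi>_def
      by eventually_elim (auto intro!: tendsto_enn2real)
    show "integrable half_line (\<lambda>x. \<psi> x powr p)" "integrable half_line (\<lambda>x. enn2real (tamping (U (r n)) x) powr p)" for n
      using LpD(2)[OF G(4)] LpD(2)[OF T(4)] by (auto simp: \<psi>_def)
    \<comment> \<open>Equimeasurability transfers this bound: the tampings and \<open>\<psi>\<close>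
      have the same p-th power integrals as \<open>F (r n)\<close> and \<open>f\<close>.\<close>
    have "limsup (\<lambda>n. \<integral>\<^sup>+x. ennreal (\<bar>F (r n) x\<bar> powr p) \<partial>half_line) \<le> (\<integral>\<^sup>+x. ennreal (\<bar>f x\<bar> powr p) \<partial>half_line)"
      by (intro limsup_nn_integral_powr_le lim_r p(2) LpD(2)[OF f(1)] LpD(2)[OF F(1)]
          LpD(2)[OF Lp_diff[OF F(1) f(1) p(2)]])
    then show "limsup (\<lambda>n. \<integral>\<^sup>+x. ennreal (enn2real (tamping (U (r n)) x) powr p) \<partial>half_line)
        \<le> (\<integral>\<^sup>+x. ennreal (\<psi> x powr p) \<partial>half_line)"
      using f F by (simp add: T(3) G(3) \<psi>_def)
  qed (auto simp: \<psi>_def)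
  moreover have "superlevel f \<nu> = superlevel \<phi> \<nu>" if "0 < \<nu>" for \<nu>
    using that by (auto simp: f_def superlevel_def)
  ultimately show ?thesis
    unfolding U_eq using r T(1,4) G(2,4)
    by (intro exI[of _ r] exI[of _ \<psi>]) (auto simp: tendsto_Lp_norm_0_iff[OF p(1)] \<psi>_def[abs_def])
qed

end
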